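(* Let $\sigma>0$ and let $B$ be a standard Brownian motion. Suppose $H\in C^{1,2}([0,1)\times\mathbb{R})$ satisfies $0\le H_y(t,y)\le C\frac{1}{\sqrt{1-t}}$ for all $(t,y)\in[0,1)\times\mathbb{R}$ and some constant $C$. Let $c\ge0$ be a constant. Then the stochastic differential equation $$dY_t=\sigma\,dB_t-cY_tH_y(t,Y_t)\,dt,\qquad Y_0=0,$$ has a unique strong solution on $[0,1]$. Moreover, for any $x>0$, $$\mathbb{E}\big[(Y_1-x)^+\big]\ge\mathbb{E}\big[(e^{-2cC}B_{\sigma^2}-x)^+\big]>0,$$ $$\mathbb{E}\big[(-x-Y_1)^+\big]\ge\mathbb{E}\big[(-x-e^{-2cC}B_{\sigma^2})^+\big]>0,$$ and, in particular, $\mathbb{P}(Y_1\le y)\in(0,1)$ for all $y\in\mathbb{R}$.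
   Context: $C^{1,2}([0,1)\times\mathbb{R})$ is the set of functions $H(t,y)$ once continuously differentiable in $t$ and twice in $y$; $H_y$ is the partial derivative in $y$. $B_{\sigma^2}$ is the value at time $\sigma^2$ of a standard Brownian motion, i.e. a normal random variable with mean $0$ and variance $\sigma^2$. $a^+=\max(a,0)$. *)

theory Defs
  imports "HOL-Probability.Probability"
begin

definition C12_on :: "real set \<Rightarrow> (real \<Rightarrow> real \<Rightarrow> real) \<Rightarrow> bool" where
  "C12_on T H \<longleftrightarrow> (\<exists>Ht Hy Hyy.
     (\<forall>t\<in>T. \<forall>y.
        ((\<lambda>s. H s y) has_real_derivative Ht t y) (at t within T) \<and>
        (H t has_real_derivative Hy t y) (at y) \<and>
        (Hy t has_real_derivative Hyy t y) (at y)) \<and>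
     continuous_on (T \<times> UNIV) (\<lambda>(t, y). H t y) \<and>
     continuous_on (T \<times> UNIV) (\<lambda>(t, y). Ht t y) \<and>
     continuous_on (T \<times> UNIV) (\<lambda>(t, y). Hy t y) \<and>
     continuous_on (T \<times> UNIV) (\<lambda>(t, y). Hyy t y))"

text \<open>
  Filtrations are indexed by the type \<^typ>\<open>real\<close>, but only times in \<open>[0, \<infinity>)\<close> are relevant.
  Path properties are required almost surely.
\<close>

locale brownian_motion_wrt = prob_space M + filtration "space M" F
  for M :: "'a measure" and F :: "real \<Rightarrow> 'a measure" +
  fixes B :: "real \<Rightarrow> 'a \<Rightarrow> real"
  assumes sets_F_subset: "\<And>t. 0 \<le> t \<Longrightarrow> sets (F t) \<subseteq> sets M"
    and adapted: "\<And>t. 0 \<le> t \<Longrightarrow> B t \<in> borel_measurable (F t)"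
    and start: "AE \<omega> in M. B 0 \<omega> = 0"
    and indep_increments: "\<And>s t. 0 \<le> s \<Longrightarrow> s < t \<Longrightarrow>
      indep_set (sets (F s)) {(\<lambda>\<omega>. B t \<omega> - B s \<omega>) -` A \<inter> space M | A. A \<in> sets borel}"
    and normal_increments: "\<And>s t. 0 \<le> s \<Longrightarrow> s < t \<Longrightarrow>
      distributed M lborel (\<lambda>\<omega>. B t \<omega> - B s \<omega>) (normal_density 0 (sqrt (t - s)))"
    and continuous_paths: "AE \<omega> in M. continuous_on {0..} (\<lambda>t. B t \<omega>)"

definition natural_filtration :: "'a measure \<Rightarrow> (real \<Rightarrow> 'a \<Rightarrow> real) \<Rightarrow> real \<Rightarrow> 'a measure" where
  "natural_filtration M B t =
     sigma (space M) {B s -` A \<inter> space M | s A. s \<in> {0..t} \<and> A \<in> sets borel}"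

definition brownian_motion :: "'a measure \<Rightarrow> (real \<Rightarrow> 'a \<Rightarrow> real) \<Rightarrow> bool" where
  "brownian_motion M B \<longleftrightarrow> brownian_motion_wrt M (natural_filtration M B) B"

text \<open>
  The augmentation adds the measurable null sets of \<open>M\<close>, so that it stays inside \<open>M\<close>;
  for complete \<open>M\<close> these are all subsets of null sets.
\<close>

definition augmented_filtration :: "'a measure \<Rightarrow> (real \<Rightarrow> 'a \<Rightarrow> real) \<Rightarrow> real \<Rightarrow> 'a measure" where
  "augmented_filtration M B t =
     sigma (space M) (sets (natural_filtration M B t) \<union> null_sets M)"

text \<open>
  \<open>Y\<close> is an \<open>F\<close>-adapted solution on \<open>[0, 1]\<close> of
  \<open>dY\<^sub>t = \<sigma> dB\<^sub>t + b(t, Y\<^sub>t) dt\<close>, \<open>Y\<^sub>0 = 0\<close>.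
  The diffusion coefficient \<open>\<sigma>\<close> is constant, so its stochastic integral over \<open>[0, t]\<close>
  is \<open>\<sigma> (B\<^sub>t - B\<^sub>0)\<close>. The drift is integrated over \<open>[0, t)\<close> because \<open>b\<close>
  is only given for times in \<open>[0, 1)\<close>.
\<close>

definition sde_solution ::
  "'a measure \<Rightarrow> (real \<Rightarrow> 'a measure) \<Rightarrow> (real \<Rightarrow> 'a \<Rightarrow> real) \<Rightarrow> real \<Rightarrow> (real \<Rightarrow> real \<Rightarrow> real)
    \<Rightarrow> (real \<Rightarrow> 'a \<Rightarrow> real) \<Rightarrow> bool" where
  "sde_solution M F B \<sigma> b Y \<longleftrightarrow>
     (\<forall>t\<in>{0..1}. Y t \<in> borel_measurable (F t)) \<and>
     (AE \<omega> in M. continuous_on {0..1} (\<lambda>t. Y t \<omega>)) \<and>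
     (AE \<omega> in M. Y 0 \<omega> = 0) \<and>
     (AE \<omega> in M. \<forall>t\<in>{0..1}.
        set_integrable lborel {0..<t} (\<lambda>s. b s (Y s \<omega>)) \<and>
        Y t \<omega> = \<sigma> * (B t \<omega> - B 0 \<omega>) + (LINT s:{0..<t}|lborel. b s (Y s \<omega>)))"

definition strong_solution ::
  "'a measure \<Rightarrow> (real \<Rightarrow> 'a \<Rightarrow> real) \<Rightarrow> real \<Rightarrow> (real \<Rightarrow> real \<Rightarrow> real)
    \<Rightarrow> (real \<Rightarrow> 'a \<Rightarrow> real) \<Rightarrow> bool" where
  "strong_solution M B \<sigma> b Y \<longleftrightarrow> sde_solution M (augmented_filtration M B) B \<sigma> b Y"

text \<open>
  Uniqueness is pathwise uniqueness: any two solutions driven by \<open>B\<close> are indistinguishable,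
  even if they are adapted only to a larger filtration for which \<open>B\<close> is a Brownian motion.
\<close>

definition has_unique_strong_solution ::
  "'a measure \<Rightarrow> (real \<Rightarrow> 'a \<Rightarrow> real) \<Rightarrow> real \<Rightarrow> (real \<Rightarrow> real \<Rightarrow> real) \<Rightarrow> bool" where
  "has_unique_strong_solution M B \<sigma> b \<longleftrightarrow>
     (\<exists>Y. strong_solution M B \<sigma> b Y) \<and>
     (\<forall>F Y Y'. brownian_motion_wrt M F B \<longrightarrow>
        sde_solution M F B \<sigma> b Y \<longrightarrow> sde_solution M F B \<sigma> b Y' \<longrightarrow>
        (AE \<omega> in M. \<forall>t\<in>{0..1}. Y t \<omega> = Y' t \<omega>))"

end

theory Submission
  imports Defs
begin

text \<open>
  Write \<open>g t y = c * H\<^sub>y(t, y)\<close> and \<open>q = c * C\<close>. The equation is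
  \<open>dY = \<sigma> dB - Y g(t, Y) dt\<close>: a linear pull towards \<open>0\<close> whose rate \<open>g\<close> depends on the state and
  satisfies \<open>0 \<le> g \<le> q / sqrt (1 - t)\<close>. This bound is singular at time \<open>1\<close> but has the finite
  integral \<open>2 q\<close>, and this is what makes everything work up to time \<open>1\<close>.

  Well-posedness. The noise is additive, so the equation is solved path by path: with
  \<open>w = \<sigma> (B - B\<^sub>0)\<close> it reads \<open>y(t) = w(t) - \<integral>\<^sub>0\<^sup>t y g(s, y) ds\<close>. The linear growth bound keeps all Picard
  iterates below \<open>exp (2 q) sup |w|\<close> on the whole of \<open>[0, 1]\<close>. On this bounded range and on
  \<open>[0, T]\<close> with \<open>T < 1\<close> the drift is Lipschitz (this uses the second derivative of \<open>H\<close> in \<open>y\<close>), so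
  consecutive iterates differ by at most \<open>D (L t)\<^sup>m / m!\<close> and converge; dominated convergence carries the
  limit to \<open>t = 1\<close>. The same factorial estimate gives uniqueness. Every iterate is a
  measurable function of the noise up to the present, hence so is the solution
  (lemmas \<open>sde_solution_exists\<close>, \<open>sde_solution_unique\<close>).

  Comparison. Let \<open>G(t)\<close> be the integral of \<open>g(s, Y\<^sub>s)\<close> over \<open>[0, t]\<close>, so \<open>0 \<le> G \<le> 2 q\<close>. The integrating
  factor removes the drift: \<open>Z = exp G(1) Y\<^sub>1\<close> is the stochastic integral of
  \<open>\<sigma> exp G\<close> against \<open>B\<close>. Its integrand is at least \<open>\<sigma>\<close>, and more volatility means more spread, so
  \<open>Z\<close> dominates \<open>\<sigma> (B\<^sub>1 - B\<^sub>0)\<close> in the convex order; the latter has the law of \<open>B\<close> at time \<open>\<sigma>\<^sup>2\<close>.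
  For \<open>x > 0\<close> the value \<open>(Y\<^sub>1 - x)\<^sup>+\<close> is at least \<open>(exp (- 2 q) Z - x)\<^sup>+\<close>: the latter is positive only if
  \<open>Z > 0\<close>, and then \<open>Y\<^sub>1 = exp (- G(1)) Z \<ge> exp (- 2 q) Z\<close>. Together these give the first estimate, and the
  mirrored test function gives the second.

  Stochastic integration is avoided. Since \<open>exp G\<close> has bounded variation, \<open>Z\<close> is
  for almost every path the limit of the Riemann sums \<open>\<Sum> \<sigma> exp G(t\<^sub>i) (B(t\<^sub>i\<^sub>+\<^sub>1) - B(t\<^sub>i))\<close> (lemma
  \<open>integrating_factor_limit\<close>). For such sums the convex comparison is an induction over the number of
  summands that uses the independence and symmetry of one Gaussian increment at a time (lemma
  \<open>martingale_transform_ge\<close>). The same induction bounds their second moments, which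
  makes the passage to the limit possible (lemma \<open>nn_integral_limit_ge\<close>).

  The statement about \<open>P(Y\<^sub>1 \<le> y)\<close> follows: probability \<open>0\<close> or \<open>1\<close> would make one of the two
  expectations vanish for a suitable \<open>x\<close>.
\<close>

section \<open>Integrals over half-open intervals and the singular kernel\<close>

text \<open>
  Here \<open>f\<close> may blow up at the right end: its gauge integral exists by the fundamental theorem with
  derivatives inside the interval, and for a nonnegative function this implies Lebesgue integrability.
\<close>

lemma FTC_nonneg_half_open:
  fixes F f :: "real \<Rightarrow> real"
  assumes "0 \<le> t" "continuous_on {0..t} F"
    and deriv: "\<And>s. 0 < s \<Longrightarrow> s < t \<Longrightarrow> (F has_real_derivative f s) (at s)"
    and nonneg: "\<And>s. 0 \<le> s \<Longrightarrow> s < t \<Longrightarrow> 0 \<le> f s"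
    and meas: "f \<in> borel_measurable borel"
  shows "set_integrable lborel {0..<t} f" "(LINT s:{0..<t}|lborel. f s) = F t - F 0"
proof -
  have "(f has_integral (F t - F 0)) {0..t}"
    by (rule fundamental_theorem_of_calculus_interior)
      (use assms in \<open>auto simp: has_real_derivative_iff_has_vector_derivative\<close>)
  then have I: "(f has_integral (F t - F 0)) {0..<t}"
    by (subst has_integral_spike_set_eq[where T="{0..t}"])
      (auto intro: negligible_subset[of "{t}"])
  then have "f absolutely_integrable_on {0..<t}"
    by (intro nonnegative_absolutely_integrable_1) (use nonneg in \<open>auto simp: has_integral_iff\<close>)
  then show int: "set_integrable lborel {0..<t} f"
    unfolding set_integrable_def using meas by (subst (asm) integrable_completion) auto
  show "(LINT s:{0..<t}|lborel. f s) = F t - F 0"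
    using set_borel_integral_eq_integral(2)[OF int] I by (simp add: has_integral_iff)
qed

lemma continuous_on_set_integral:
  fixes f :: "real \<Rightarrow> real"
  assumes int: "set_integrable lborel {0..<1} f"
  shows "continuous_on {0..1} (\<lambda>t. LINT s:{0..<t}|lborel. f s)"
proof -
  have "continuous_on {0..1} (\<lambda>t. integral {0..t} f)"
  proof (rule indefinite_integral_continuous_1)
    have "f integrable_on {0..<1}"
      by (rule set_borel_integral_eq_integral[OF int])
    then show "f integrable_on {0..1}"
      by (rule integrable_spike_set) (rule negligible_subset[of "{1}"]; force)+
  qed
  moreover have "(LINT s:{0..<t}|lborel. f s) = integral {0..t} f" if "t \<in> {0..1}" for t
  proof -
    have "set_integrable lborel {0..<t} f"
      by (rule set_integrable_subset[OF int]) (use that in auto)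
    then have "(LINT s:{0..<t}|lborel. f s) = integral {0..<t} f"
      by (rule set_borel_integral_eq_integral)
    also have "\<dots> = integral {0..t} f"
      by (rule integral_spike_set) (rule negligible_subset[of "{t}"]; force)+
    finally show ?thesis .
  qed
  ultimately show ?thesis
    by (subst continuous_on_cong[OF refl]) auto
qed

lemma set_integral_half_open_split:
  fixes f :: "real \<Rightarrow> real"
  assumes "set_integrable lborel {0..<1} f" "0 \<le> s" "s \<le> t" "t \<le> 1"
  shows "(LINT r:{0..<t}|lborel. f r) - (LINT r:{0..<s}|lborel. f r) = (LINT r:{s..<t}|lborel. f r)"
proof -
  have "{0..<t} = {0..<s} \<union> {s..<t}" using assms by auto
  moreover have "(LINT r:{0..<s} \<union> {s..<t}|lborel. f r)
      = (LINT r:{0..<s}|lborel. f r) + (LINT r:{s..<t}|lborel. f r)"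
    by (rule set_integral_Un) (use assms in \<open>auto intro: set_integrable_subset[OF assms(1)]\<close>)
  ultimately show ?thesis by simp
qed

text \<open>
  The estimate behind both the convergence of the Picard iterates and the uniqueness of solutions: each
  integration of the bound \<open>D (L s)\<^sup>m / m!\<close> raises the power by one.
\<close>

lemma factorial_bound:
  fixes d :: "nat \<Rightarrow> real \<Rightarrow> real"
  assumes base: "\<And>t. t \<in> {0..T} \<Longrightarrow> \<bar>d 0 t\<bar> \<le> D"
    and step: "\<And>m t. t \<in> {0..T} \<Longrightarrow> \<bar>d (Suc m) t\<bar> \<le> L * (LINT s:{0..<t}|lborel. \<bar>d m s\<bar>)"
    and int: "\<And>m t. t \<in> {0..T} \<Longrightarrow> set_integrable lborel {0..<t} (\<lambda>s. \<bar>d m s\<bar>)"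
    and "0 \<le> L" "0 \<le> D" and "t \<in> {0..T}"
  shows "\<bar>d m t\<bar> \<le> D * (L * t) ^ m / fact m"
  using \<open>t \<in> {0..T}\<close>
proof (induction m arbitrary: t)
  case 0
  then show ?case using base by simp
next
  case (Suc m)
  let ?f = "\<lambda>s. D * (L * s) ^ m / fact m"
  let ?F = "\<lambda>s. D * L ^ m * s ^ Suc m / fact (Suc m)"
  have t: "0 \<le> t" using Suc by simp
  have der: "(?F has_real_derivative ?f s) (at s)" for s
  proof -
    have "D * L ^ m * (real (Suc m) * s ^ (Suc m - Suc 0)) / fact (Suc m) = ?f s"
      by (simp add: power_mult_distrib fact_Suc del: of_nat_Suc)
    then show ?thesis
      by (rule DERIV_cong[OF DERIV_cdivide[OF DERIV_cmult[OF DERIV_pow]]])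
  qed
  have F: "set_integrable lborel {0..<t} ?f" "(LINT s:{0..<t}|lborel. ?f s) = ?F t - ?F 0"
    by (rule FTC_nonneg_half_open[OF t _ der];
        use \<open>0 \<le> D\<close> \<open>0 \<le> L\<close> in \<open>auto intro!: continuous_intros\<close>)+
  have "\<bar>d (Suc m) t\<bar> \<le> L * (LINT s:{0..<t}|lborel. \<bar>d m s\<bar>)"
    by (rule step[OF Suc.prems])
  also have "\<dots> \<le> L * (LINT s:{0..<t}|lborel. ?f s)"
    by (intro mult_left_mono set_integral_mono int[OF Suc.prems] F)
      (use Suc \<open>0 \<le> L\<close> in auto)
  also have "\<dots> = D * (L * t) ^ Suc m / fact (Suc m)"
    unfolding F by (simp add: power_mult_distrib)
  finally show ?case .
qed

lemma factorial_bound_tendsto_0: "(\<lambda>m. D * x ^ m / fact m :: real) \<longlonglongrightarrow> 0"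
proof -
  have "(\<lambda>m. D * (inverse (fact m) * x ^ m)) \<longlonglongrightarrow> D * 0"
    by (intro tendsto_mult tendsto_const summable_LIMSEQ_zero summable_exp)
  then show ?thesis by (simp add: field_simps)
qed

text \<open>
  The integral of \<open>q / sqrt (1 - s)\<close> over \<open>[0, t]\<close>.
\<close>

definition kernel_integral :: "real \<Rightarrow> real \<Rightarrow> real" where
  "kernel_integral q t = q * (2 - 2 * sqrt (1 - t))"

lemma has_derivative_kernel_integral:
  assumes "s < 1"
  shows "(kernel_integral q has_real_derivative q / sqrt (1 - s)) (at s)"
  unfolding kernel_integral_def[abs_def]
  by (rule derivative_eq_intros refl | use assms in \<open>force simp: field_simps\<close>)+

lemma continuous_on_kernel_integral: "continuous_on A (kernel_integral q)"
  unfolding kernel_integral_def[abs_def] by (intro continuous_intros)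

lemma kernel_integral_0 [simp]: "kernel_integral q 0 = 0"
  by (simp add: kernel_integral_def)

lemma kernel_integral_bounds:
  assumes "0 \<le> q" "t \<in> {0..1}"
  shows "0 \<le> kernel_integral q t" "kernel_integral q t \<le> 2 * q"
  using assms by (auto simp: kernel_integral_def algebra_simps mult_left_le)

lemma kernel_integrable:
  assumes "0 \<le> q" "t \<in> {0..1}"
  shows "set_integrable lborel {0..<t} (\<lambda>s. q / sqrt (1 - s))"
    and "(LINT s:{0..<t}|lborel. q / sqrt (1 - s)) = kernel_integral q t"
  using FTC_nonneg_half_open[of t "kernel_integral q" "\<lambda>s. q / sqrt (1 - s)"] assms
    has_derivative_kernel_integral continuous_on_kernel_integral by auto

text \<open>
  The function \<open>exp (kernel_integral q)\<close> solves the linear equation \<open>z' = q z / sqrt (1 - t)\<close>. Hence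
  \<open>1\<close> plus its integral against the kernel is the function itself: it is a fixed point of the operator that
  bounds one Picard step.
\<close>

lemma exp_kernel_integrable:
  assumes "0 \<le> q" "t \<in> {0..1}"
  shows "set_integrable lborel {0..<t} (\<lambda>s. q / sqrt (1 - s) * exp (kernel_integral q s))"
    and "(LINT s:{0..<t}|lborel. q / sqrt (1 - s) * exp (kernel_integral q s))
      = exp (kernel_integral q t) - 1"
proof -
  have der: "((\<lambda>s. exp (kernel_integral q s)) has_real_derivative
      q / sqrt (1 - s) * exp (kernel_integral q s)) (at s)" if "s < 1" for s
    by (rule derivative_eq_intros has_derivative_kernel_integral that refl)+ simp
  have meas: "kernel_integral q \<in> borel_measurable borel"
    by (intro borel_measurable_continuous_onI continuous_on_kernel_integral)
  have "continuous_on {0..t} (\<lambda>s. exp (kernel_integral q s))"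
    by (intro continuous_intros continuous_on_kernel_integral)
  then show "set_integrable lborel {0..<t} (\<lambda>s. q / sqrt (1 - s) * exp (kernel_integral q s))"
    and "(LINT s:{0..<t}|lborel. q / sqrt (1 - s) * exp (kernel_integral q s))
      = exp (kernel_integral q t) - 1"
    using FTC_nonneg_half_open[of t "\<lambda>s. exp (kernel_integral q s)"
        "\<lambda>s. q / sqrt (1 - s) * exp (kernel_integral q s)"] assms der meas by auto
qed

section \<open>The pathwise equation\<close>

lemma bounded_path:
  fixes y :: "real \<Rightarrow> real"
  assumes "continuous_on {0..1} y"
  obtains R where "0 \<le> R" "\<And>s. s \<in> {0..1} \<Longrightarrow> \<bar>y s\<bar> \<le> R"
proof -
  have "compact (y ` {0..1})"
    by (intro compact_continuous_image assms compact_Icc)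
  then obtain R where "\<And>x. x \<in> y ` {0..1} \<Longrightarrow> \<bar>x\<bar> \<le> R"
    using compact_imp_bounded[THEN bounded_iff[THEN iffD1]] by (metis real_norm_def)
  then have "\<And>s. s \<in> {0..1} \<Longrightarrow> \<bar>y s\<bar> \<le> max 0 R" by fastforce
  then show ?thesis using that[of "max 0 R"] by simp
qed

text \<open>
  The drift is \<open>- y * g t y\<close>. The Lipschitz constant depends on the time horizon \<open>T < 1\<close> and on the
  range \<open>R\<close>, since in the application \<open>H\<^sub>y\<^sub>y\<close> may be unbounded in \<open>y\<close> and as \<open>t\<close> tends to \<open>1\<close>.
\<close>

locale restoring_drift =
  fixes g :: "real \<Rightarrow> real \<Rightarrow> real" and q :: real
  assumes g_cont: "continuous_on ({0..<1} \<times> UNIV) (\<lambda>(s, y). g s y)"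
    and g_nonneg: "\<And>s y. s \<in> {0..<1} \<Longrightarrow> 0 \<le> g s y"
    and g_le: "\<And>s y. s \<in> {0..<1} \<Longrightarrow> g s y \<le> q / sqrt (1 - s)"
    and drift_lipschitz: "\<And>T R. T < 1 \<Longrightarrow> \<exists>L. \<forall>s\<in>{0..T}. \<forall>x y.
      \<bar>x\<bar> \<le> R \<longrightarrow> \<bar>y\<bar> \<le> R \<longrightarrow> \<bar>x * g s x - y * g s y\<bar> \<le> L * \<bar>x - y\<bar>"
begin

lemma q_nonneg: "0 \<le> q"
  using g_nonneg[of 0 0] g_le[of 0 0] by simp

lemma g_path_continuous:
  assumes "continuous_on {0..1} y"
  shows "continuous_on {0..<1} (\<lambda>s. g s (y s))"
proof -
  have "continuous_on {0..<1} (\<lambda>s. (s, y s))"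
    by (intro continuous_intros continuous_on_subset[OF assms]) auto
  from continuous_on_compose2[OF g_cont this] show ?thesis by auto
qed

lemma g_path_integrable:
  assumes "continuous_on {0..1} y"
  shows "set_integrable lborel {0..<1} (\<lambda>s. g s (y s))"
proof (rule set_integrable_bound)
  show "set_integrable lborel {0..<1} (\<lambda>s. q / sqrt (1 - s))"
    by (rule kernel_integrable) (auto simp: q_nonneg)
  show "set_borel_measurable lborel {0..<1} (\<lambda>s. g s (y s))"
    unfolding set_borel_measurable_def
    using borel_measurable_continuous_on_indicator[OF _ g_path_continuous[OF assms]] by simp
  show "AE s in lborel. s \<in> {0..<1} \<longrightarrow> norm (g s (y s)) \<le> norm (q / sqrt (1 - s))"
    using g_nonneg g_le q_nonneg by (auto intro!: AE_I2)
qed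

lemma g_integral_bounds:
  assumes "continuous_on {0..1} y" "t \<in> {0..1}"
  shows "0 \<le> (LINT s:{0..<t}|lborel. g s (y s))" "(LINT s:{0..<t}|lborel. g s (y s)) \<le> 2 * q"
proof -
  have sub: "set_integrable lborel {0..<t} (\<lambda>s. g s (y s))"
    by (rule set_integrable_subset[OF g_path_integrable[OF assms(1)]]) (use assms in auto)
  show "0 \<le> (LINT s:{0..<t}|lborel. g s (y s))"
    unfolding set_lebesgue_integral_def
    by (rule integral_nonneg_AE) (use g_nonneg assms in \<open>auto simp: indicator_def\<close>)
  have "(LINT s:{0..<t}|lborel. g s (y s)) \<le> (LINT s:{0..<t}|lborel. q / sqrt (1 - s))"
    by (intro set_integral_mono sub kernel_integrable q_nonneg assms g_le) (use assms in auto)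
  also have "\<dots> \<le> 2 * q"
    using kernel_integrable(2)[OF q_nonneg assms(2)] kernel_integral_bounds(2)[OF q_nonneg assms(2)]
    by simp
  finally show "(LINT s:{0..<t}|lborel. g s (y s)) \<le> 2 * q" .
qed

lemma drift_path_integrable:
  assumes "continuous_on {0..1} y"
  shows "set_integrable lborel {0..<1} (\<lambda>s. y s * g s (y s))"
proof -
  obtain R where R: "0 \<le> R" "\<And>s. s \<in> {0..1} \<Longrightarrow> \<bar>y s\<bar> \<le> R"
    using bounded_path[OF assms] by blast
  have "continuous_on {0..<1} (\<lambda>s. y s * g s (y s))"
    by (intro continuous_intros g_path_continuous assms continuous_on_subset[OF assms]) auto
  note meas = borel_measurable_continuous_on_indicator[OF _ this]
  show ?thesis
  proof (rule set_integrable_bound)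
    show "set_integrable lborel {0..<1} (\<lambda>s. R * g s (y s))"
      by (intro set_integrable_mult_right g_path_integrable assms)
    show "set_borel_measurable lborel {0..<1} (\<lambda>s. y s * g s (y s))"
      unfolding set_borel_measurable_def using meas by simp
    show "AE s in lborel. s \<in> {0..<1} \<longrightarrow> norm (y s * g s (y s)) \<le> norm (R * g s (y s))"
      using g_nonneg R by (auto intro!: AE_I2 mult_right_mono simp: abs_mult)
  qed
qed

lemma drift_path_integrable_upto:
  assumes "continuous_on {0..1} y" "t \<le> 1"
  shows "set_integrable lborel {0..<t} (\<lambda>s. y s * g s (y s))"
  by (rule set_integrable_subset[OF drift_path_integrable[OF assms(1)]]) (use assms in auto)

fun picard :: "(real \<Rightarrow> real) \<Rightarrow> nat \<Rightarrow> real \<Rightarrow> real" where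
  "picard w 0 = w"
| "picard w (Suc m) = (\<lambda>t. w t - (LINT s:{0..<t}|lborel. picard w m s * g s (picard w m s)))"

lemma continuous_on_picard:
  assumes "continuous_on {0..1} w"
  shows "continuous_on {0..1} (picard w m)"
proof (induction m)
  case (Suc m)
  show ?case
    unfolding picard.simps
    by (intro continuous_intros assms continuous_on_set_integral drift_path_integrable Suc)
qed (simp add: assms)

text \<open>
  The bound is a fixed point of the linear integral operator that dominates one Picard step, so it
  propagates from each iterate to the next with the same constant \<open>W\<close>. Hence all iterates stay in one
  bounded range on the whole interval, where the local Lipschitz bound applies.
\<close>

lemma picard_bound:
  assumes w: "continuous_on {0..1} w" and W: "\<And>t. t \<in> {0..1} \<Longrightarrow> \<bar>w t\<bar> \<le> W"
    and "t \<in> {0..1}"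
  shows "\<bar>picard w m t\<bar> \<le> W * exp (kernel_integral q t)"
  using \<open>t \<in> {0..1}\<close>
proof (induction m arbitrary: t)
  case 0
  have "W * 1 \<le> W * exp (kernel_integral q t)"
    using W[OF 0] kernel_integral_bounds(1)[OF q_nonneg 0] by (intro mult_left_mono) auto
  with W[OF 0] show ?case by simp
next
  case (Suc m)
  note int = drift_path_integrable_upto[OF continuous_on_picard[OF w], of t m]
  have "\<bar>LINT s:{0..<t}|lborel. picard w m s * g s (picard w m s)\<bar>
      \<le> (LINT s:{0..<t}|lborel. \<bar>picard w m s * g s (picard w m s)\<bar>)"
    using set_integral_norm_bound[OF int] Suc.prems by simp
  also have "\<dots> \<le> (LINT s:{0..<t}|lborel. W * (q / sqrt (1 - s) * exp (kernel_integral q s)))"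
  proof (rule set_integral_mono)
    show "set_integrable lborel {0..<t} (\<lambda>s. \<bar>picard w m s * g s (picard w m s)\<bar>)"
      using int Suc.prems by (intro set_integrable_abs) simp
    show "set_integrable lborel {0..<t} (\<lambda>s. W * (q / sqrt (1 - s) * exp (kernel_integral q s)))"
      by (intro set_integrable_mult_right exp_kernel_integrable q_nonneg Suc.prems)
    fix s assume s: "s \<in> {0..<t}"
    have "\<bar>picard w m s * g s (picard w m s)\<bar> \<le> (W * exp (kernel_integral q s)) * (q / sqrt (1 - s))"
      unfolding abs_mult
      by (rule mult_mono) (use s Suc g_le g_nonneg W[of 0] in auto)
    then show "\<bar>picard w m s * g s (picard w m s)\<bar>
        \<le> W * (q / sqrt (1 - s) * exp (kernel_integral q s))"
      by (simp add: mult_ac)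
  qed
  also have "\<dots> = W * (exp (kernel_integral q t) - 1)"
    by (simp only: set_integral_mult_right exp_kernel_integrable(2)[OF q_nonneg Suc.prems])
  finally have "\<bar>LINT s:{0..<t}|lborel. picard w m s * g s (picard w m s)\<bar>
      \<le> W * exp (kernel_integral q t) - W" by (simp add: algebra_simps)
  with W[OF Suc.prems] show ?case by simp
qed

lemma picard_bound_uniform:
  assumes w: "continuous_on {0..1} w" and W: "\<And>t. t \<in> {0..1} \<Longrightarrow> \<bar>w t\<bar> \<le> W"
    and "t \<in> {0..1}"
  shows "\<bar>picard w m t\<bar> \<le> W * exp (2 * q)"
proof -
  have "W * exp (kernel_integral q t) \<le> W * exp (2 * q)"
    using W[of 0] kernel_integral_bounds(2)[OF q_nonneg \<open>t \<in> {0..1}\<close>] by (intro mult_left_mono) auto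
  with picard_bound[OF assms, of m] show ?thesis by linarith
qed

lemma drift_lipschitz_nonneg:
  assumes "T < 1"
  obtains L where "0 \<le> L" "\<And>s x y. s \<in> {0..T} \<Longrightarrow> \<bar>x\<bar> \<le> R \<Longrightarrow> \<bar>y\<bar> \<le> R \<Longrightarrow>
    \<bar>x * g s x - y * g s y\<bar> \<le> L * \<bar>x - y\<bar>"
proof -
  obtain L where L: "\<forall>s\<in>{0..T}. \<forall>x y. \<bar>x\<bar> \<le> R \<longrightarrow> \<bar>y\<bar> \<le> R \<longrightarrow>
      \<bar>x * g s x - y * g s y\<bar> \<le> L * \<bar>x - y\<bar>"
    using drift_lipschitz[OF assms] by blast
  have "\<bar>x * g s x - y * g s y\<bar> \<le> max 0 L * \<bar>x - y\<bar>"
    if "s \<in> {0..T}" "\<bar>x\<bar> \<le> R" "\<bar>y\<bar> \<le> R" for s x y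
    using L that by (meson abs_ge_zero max.cobounded2 mult_right_mono order_trans)
  then show ?thesis using that[of "max 0 L"] by simp
qed

lemma drift_integral_difference:
  assumes x: "continuous_on {0..1} x" "\<And>s. s \<in> {0..T} \<Longrightarrow> \<bar>x s\<bar> \<le> R"
    and y: "continuous_on {0..1} y" "\<And>s. s \<in> {0..T} \<Longrightarrow> \<bar>y s\<bar> \<le> R"
    and L: "\<And>s x y. s \<in> {0..T} \<Longrightarrow> \<bar>x\<bar> \<le> R \<Longrightarrow> \<bar>y\<bar> \<le> R \<Longrightarrow>
      \<bar>x * g s x - y * g s y\<bar> \<le> L * \<bar>x - y\<bar>"
    and t: "t \<in> {0..T}" "T < 1"
  shows "\<bar>(LINT s:{0..<t}|lborel. x s * g s (x s)) - (LINT s:{0..<t}|lborel. y s * g s (y s))\<bar>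
    \<le> L * (LINT s:{0..<t}|lborel. \<bar>x s - y s\<bar>)"
    and "set_integrable lborel {0..<t} (\<lambda>s. \<bar>x s - y s\<bar>)"
proof -
  have "set_integrable lborel {0..t} (\<lambda>s. \<bar>x s - y s\<bar>)"
    unfolding set_integrable_def
    by (rule borel_integrable_compact)
      (use t in \<open>auto intro!: continuous_intros intro: continuous_on_subset[OF x(1)] continuous_on_subset[OF y(1)]\<close>)
  then show int: "set_integrable lborel {0..<t} (\<lambda>s. \<bar>x s - y s\<bar>)"
    by (rule set_integrable_subset) auto
  have ix: "set_integrable lborel {0..<t} (\<lambda>s. x s * g s (x s))"
    by (rule drift_path_integrable_upto[OF x(1)]) (use t in auto)
  have iy: "set_integrable lborel {0..<t} (\<lambda>s. y s * g s (y s))"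
    by (rule drift_path_integrable_upto[OF y(1)]) (use t in auto)
  note d = set_integral_diff[OF ix iy]
  have "\<bar>LINT s:{0..<t}|lborel. x s * g s (x s) - y s * g s (y s)\<bar>
      \<le> (LINT s:{0..<t}|lborel. \<bar>x s * g s (x s) - y s * g s (y s)\<bar>)"
    using set_integral_norm_bound[OF d(1)] by simp
  also have "\<dots> \<le> (LINT s:{0..<t}|lborel. L * \<bar>x s - y s\<bar>)"
    by (intro set_integral_mono set_integrable_abs d set_integrable_mult_right int L x y)
      (use t in auto)
  finally show "\<bar>(LINT s:{0..<t}|lborel. x s * g s (x s)) - (LINT s:{0..<t}|lborel. y s * g s (y s))\<bar>
      \<le> L * (LINT s:{0..<t}|lborel. \<bar>x s - y s\<bar>)"
    by (simp add: d)
qed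

lemma convergent_picard_before_1:
  assumes w: "continuous_on {0..1} w" and t: "t \<in> {0..<1}"
  shows "convergent (\<lambda>m. picard w m t)"
proof -
  obtain W where W: "0 \<le> W" "\<And>s. s \<in> {0..1} \<Longrightarrow> \<bar>w s\<bar> \<le> W"
    using bounded_path[OF w] by blast
  define R where "R = W * exp (2 * q)"
  have R: "\<bar>picard w m s\<bar> \<le> R" if "s \<in> {0..t}" for m s
    unfolding R_def using t that by (intro picard_bound_uniform w W) auto
  obtain L where L: "0 \<le> L" "\<And>s x y. s \<in> {0..t} \<Longrightarrow> \<bar>x\<bar> \<le> R \<Longrightarrow> \<bar>y\<bar> \<le> R \<Longrightarrow>
      \<bar>x * g s x - y * g s y\<bar> \<le> L * \<bar>x - y\<bar>"
    using drift_lipschitz_nonneg[of t R] t by auto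
  define d where "d m s = picard w (Suc m) s - picard w m s" for m s
  have diff: "\<bar>d (Suc m) s\<bar> \<le> L * (LINT r:{0..<s}|lborel. \<bar>d m r\<bar>)"
    "set_integrable lborel {0..<s} (\<lambda>r. \<bar>d m r\<bar>)" if s: "s \<in> {0..t}" for m s
  proof -
    have R': "\<And>r. r \<in> {0..t} \<Longrightarrow> \<bar>picard w (Suc m) r\<bar> \<le> R" "\<And>r. r \<in> {0..t} \<Longrightarrow> \<bar>picard w m r\<bar> \<le> R"
      by (rule R, assumption)+
    have "t < 1" using t by simp
    note * = drift_integral_difference[where T = t and R = R and L = L and t = s
        and x = "picard w (Suc m)" and y = "picard w m",
        OF continuous_on_picard[OF w] R'(1) continuous_on_picard[OF w] R'(2) L(2) s \<open>t < 1\<close>]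
    have "\<bar>d (Suc m) s\<bar> = \<bar>(LINT r:{0..<s}|lborel. picard w (Suc m) r * g r (picard w (Suc m) r))
        - (LINT r:{0..<s}|lborel. picard w m r * g r (picard w m r))\<bar>"
      unfolding d_def by (simp add: abs_minus_commute)
    also have "\<dots> \<le> L * (LINT r:{0..<s}|lborel. \<bar>d m r\<bar>)"
      unfolding d_def by (rule *(1))
    finally show "\<bar>d (Suc m) s\<bar> \<le> L * (LINT r:{0..<s}|lborel. \<bar>d m r\<bar>)" .
    show "set_integrable lborel {0..<s} (\<lambda>r. \<bar>d m r\<bar>)"
      unfolding d_def by (rule *(2))
  qed
  have "\<bar>d m t\<bar> \<le> (2 * R) * (L * t) ^ m / fact m" for m
  proof (rule factorial_bound[where T = t])
    show "\<bar>d 0 s\<bar> \<le> 2 * R" if "s \<in> {0..t}" for s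
      using R[OF that, of 0] R[OF that, of 1] unfolding d_def by simp
    show "\<bar>d (Suc m) s\<bar> \<le> L * (LINT r:{0..<s}|lborel. \<bar>d m r\<bar>)" if "s \<in> {0..t}" for m s
      by (rule diff(1)[OF that])
    show "set_integrable lborel {0..<s} (\<lambda>r. \<bar>d m r\<bar>)" if "s \<in> {0..t}" for m s
      by (rule diff(2)[OF that])
    show "0 \<le> L" "0 \<le> 2 * R" "t \<in> {0..t}" using L t W(1) by (auto simp: R_def)
  qed
  moreover have "summable (\<lambda>m. (2 * R) * (L * t) ^ m / fact m)"
    using summable_mult[OF summable_exp[of "L * t"], of "2 * R"] by (simp add: field_simps)
  ultimately have "summable (\<lambda>m. d m t)"
    by (intro summable_comparison_test[of "\<lambda>m. d m t"]) auto
  then have "convergent (\<lambda>m. \<Sum>i<m. d i t)"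
    by (simp add: summable_iff_convergent)
  then have "convergent (\<lambda>m. (\<Sum>i<m. d i t) + picard w 0 t)"
    by (intro convergent_add convergent_const)
  moreover have "(\<Sum>i<m. d i t) + picard w 0 t = picard w m t" for m
    unfolding d_def by (subst sum_lessThan_telescope) simp
  ultimately show ?thesis by simp
qed

definition solution :: "(real \<Rightarrow> real) \<Rightarrow> real \<Rightarrow> real" where
  "solution w t = lim (\<lambda>m. picard w m t)"

text \<open>
  Convergence before time \<open>1\<close> suffices: the integral over \<open>[0, t)\<close> does not see the time \<open>t\<close>, so
  dominated convergence with dominating function a multiple of \<open>q / sqrt (1 - s)\<close> yields convergence also
  at \<open>t = 1\<close>, together with the integral equation. Continuity is read off from that equation.
\<close>

lemma
  assumes w: "continuous_on {0..1} w"
  shows picard_tendsto_solution: "\<And>t. t \<in> {0..1} \<Longrightarrow> (\<lambda>m. picard w m t) \<longlonglongrightarrow> solution w t"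
    and solution_eq: "\<And>t. t \<in> {0..1} \<Longrightarrow>
      solution w t = w t - (LINT s:{0..<t}|lborel. solution w s * g s (solution w s))"
    and continuous_on_solution: "continuous_on {0..1} (solution w)"
proof -
  let ?z = "solution w"
  obtain W where W: "0 \<le> W" "\<And>s. s \<in> {0..1} \<Longrightarrow> \<bar>w s\<bar> \<le> W"
    using bounded_path[OF w] by blast
  have lim: "(\<lambda>m. picard w m s) \<longlonglongrightarrow> ?z s" if "s \<in> {0..<1}" for s
    unfolding solution_def using convergent_picard_before_1[OF w that] by (simp add: convergent_LIMSEQ_iff)
  have lim_drift: "(\<lambda>m. picard w m s * g s (picard w m s)) \<longlonglongrightarrow> ?z s * g s (?z s)"
    if s: "s \<in> {0..<1}" for s
  proof (intro tendsto_mult lim s)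
    have "continuous_on UNIV (\<lambda>y. case (s, y) of (s, y) \<Rightarrow> g s y)"
      by (rule continuous_on_compose2[OF g_cont]) (use s in \<open>auto intro!: continuous_intros\<close>)
    then have "isCont (g s) (?z s)" by (simp add: continuous_on_eq_continuous_at)
    then show "(\<lambda>m. g s (picard w m s)) \<longlonglongrightarrow> g s (?z s)"
      by (rule isCont_tendsto_compose) (rule lim[OF s])
  qed
  let ?f = "\<lambda>t m s. indicator {0..<t} s *\<^sub>R (picard w m s * g s (picard w m s))"
  let ?h = "\<lambda>t s. indicator {0..<t} s *\<^sub>R (?z s * g s (?z s))"
  let ?b = "\<lambda>t s. indicator {0..<t} s *\<^sub>R (W * exp (2 * q) * (q / sqrt (1 - s)))"
  have conv: "integrable lborel (?h t)" "(\<lambda>m. integral\<^sup>L lborel (?f t m)) \<longlonglongrightarrow> integral\<^sup>L lborel (?h t)"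
    if t: "t \<in> {0..1}" for t
  proof -
    have meas: "?f t m \<in> borel_measurable lborel" for m
      using drift_path_integrable_upto[OF continuous_on_picard[OF w], of t m] t
      by (auto simp: set_integrable_def)
    have lims: "(\<lambda>m. ?f t m s) \<longlonglongrightarrow> ?h t s" for s
      using lim_drift[of s] t by (cases "s \<in> {0..<t}") auto
    have meas': "?h t \<in> borel_measurable lborel"
      by (rule borel_measurable_LIMSEQ_real[OF lims meas])
    have bint: "integrable lborel (?b t)"
      using set_integrable_mult_right[OF kernel_integrable(1)[OF q_nonneg t]]
      by (simp add: set_integrable_def)
    have bound: "norm (?f t m s) \<le> ?b t s" for m s
    proof (cases "s \<in> {0..<t}")
      case True
      then have "\<bar>picard w m s\<bar> * g s (picard w m s) \<le> W * exp (2 * q) * (q / sqrt (1 - s))"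
        using picard_bound_uniform[OF w W(2), of s m] t W(1) g_nonneg g_le by (intro mult_mono) auto
      then show ?thesis
        using True t g_nonneg[of s] by (simp add: abs_mult)
    qed auto
    show "integrable lborel (?h t)"
      by (rule integrable_dominated_convergence[where s = "?f t", OF meas' meas bint]) (use lims bound in auto)
    show "(\<lambda>m. integral\<^sup>L lborel (?f t m)) \<longlonglongrightarrow> integral\<^sup>L lborel (?h t)"
      by (rule integral_dominated_convergence[where s = "?f t", OF meas' meas bint]) (use lims bound in auto)
  qed
  have lim_Suc: "(\<lambda>m. picard w (Suc m) t) \<longlonglongrightarrow> w t - (LINT s:{0..<t}|lborel. ?z s * g s (?z s))"
    if "t \<in> {0..1}" for t
    using tendsto_diff[OF tendsto_const conv(2)[OF that], of "w t"]
    by (simp add: set_lebesgue_integral_def)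
  show eq: "?z t = w t - (LINT s:{0..<t}|lborel. ?z s * g s (?z s))" if "t \<in> {0..1}" for t
    unfolding solution_def[of w t]
    by (rule limI) (rule LIMSEQ_imp_Suc[OF lim_Suc[OF that]])
  show "(\<lambda>m. picard w m t) \<longlonglongrightarrow> ?z t" if "t \<in> {0..1}" for t
    using LIMSEQ_imp_Suc[OF lim_Suc[OF that]] eq[OF that] by simp
  have "continuous_on {0..1} (\<lambda>t. w t - (LINT s:{0..<t}|lborel. ?z s * g s (?z s)))"
    using conv(1)[of 1] by (intro continuous_intros w continuous_on_set_integral) (simp add: set_integrable_def)
  then show "continuous_on {0..1} ?z"
    by (subst continuous_on_cong[OF refl eq])
qed

text \<open>
  A difference of two solutions is bounded by the integral of itself, so it lies below every term of the
  factorial sequence. Time \<open>1\<close> is reached by continuity.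
\<close>

lemma solution_unique:
  assumes x: "continuous_on {0..1} x"
    "\<And>t. t \<in> {0..1} \<Longrightarrow> x t = w t - (LINT s:{0..<t}|lborel. x s * g s (x s))"
    and y: "continuous_on {0..1} y"
    "\<And>t. t \<in> {0..1} \<Longrightarrow> y t = w t - (LINT s:{0..<t}|lborel. y s * g s (y s))"
    and t: "t \<in> {0..1}"
  shows "x t = y t"
proof -
  have before_1: "x t = y t" if t: "t \<in> {0..<1}" for t
  proof -
    obtain Rx where Rx: "0 \<le> Rx" "\<And>s. s \<in> {0..1} \<Longrightarrow> \<bar>x s\<bar> \<le> Rx"
      using bounded_path[OF x(1)] by blast
    obtain Ry where Ry: "0 \<le> Ry" "\<And>s. s \<in> {0..1} \<Longrightarrow> \<bar>y s\<bar> \<le> Ry"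
      using bounded_path[OF y(1)] by blast
    define R where "R = Rx + Ry"
    have R: "\<bar>x s\<bar> \<le> R" "\<bar>y s\<bar> \<le> R" if "s \<in> {0..t}" for s
      using Rx Ry that t unfolding R_def by (simp_all add: add_increasing add_increasing2)
    obtain L where L: "0 \<le> L" "\<And>s x y. s \<in> {0..t} \<Longrightarrow> \<bar>x\<bar> \<le> R \<Longrightarrow> \<bar>y\<bar> \<le> R \<Longrightarrow>
        \<bar>x * g s x - y * g s y\<bar> \<le> L * \<bar>x - y\<bar>"
      using drift_lipschitz_nonneg[of t R] t by auto
    have diff: "\<bar>x s - y s\<bar> \<le> L * (LINT r:{0..<s}|lborel. \<bar>x r - y r\<bar>)"
      "set_integrable lborel {0..<s} (\<lambda>r. \<bar>x r - y r\<bar>)" if s: "s \<in> {0..t}" for s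
    proof -
      have "t < 1" using t by simp
      note * = drift_integral_difference[where T = t and R = R and L = L and t = s,
          OF x(1) R(1) y(1) R(2) L(2) s \<open>t < 1\<close>]
      have "\<bar>x s - y s\<bar> = \<bar>(LINT r:{0..<s}|lborel. x r * g r (x r))
          - (LINT r:{0..<s}|lborel. y r * g r (y r))\<bar>"
        using x(2)[of s] y(2)[of s] t s by (simp add: abs_minus_commute)
      also have "\<dots> \<le> L * (LINT r:{0..<s}|lborel. \<bar>x r - y r\<bar>)"
        by (rule *(1))
      finally show "\<bar>x s - y s\<bar> \<le> L * (LINT r:{0..<s}|lborel. \<bar>x r - y r\<bar>)" .
      show "set_integrable lborel {0..<s} (\<lambda>r. \<bar>x r - y r\<bar>)"
        by (rule *(2))
    qed
    have "\<bar>x t - y t\<bar> \<le> (2 * R) * (L * t) ^ m / fact m" for m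
    proof (rule factorial_bound[where T = t and d = "\<lambda>_ s. x s - y s"])
      show "\<bar>x s - y s\<bar> \<le> 2 * R" if "s \<in> {0..t}" for s
        using R[OF that] by linarith
      show "\<bar>x s - y s\<bar> \<le> L * (LINT r:{0..<s}|lborel. \<bar>x r - y r\<bar>)" if "s \<in> {0..t}" for s
        by (rule diff(1)[OF that])
      show "set_integrable lborel {0..<s} (\<lambda>r. \<bar>x r - y r\<bar>)" if "s \<in> {0..t}" for s
        by (rule diff(2)[OF that])
      show "0 \<le> L" "0 \<le> 2 * R" "t \<in> {0..t}" using L t Rx Ry by (auto simp: R_def)
    qed
    then have "\<bar>x t - y t\<bar> \<le> 0"
      by (intro LIMSEQ_le_const[OF factorial_bound_tendsto_0]) auto
    then show ?thesis by simp
  qed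
  have "{0..1} = closure {0..<1::real}" by simp
  moreover have "continuous_on {0..1} (\<lambda>t. x t - y t)"
    by (intro continuous_intros x(1) y(1))
  moreover have "t \<in> closure {0..<1}" using t by simp
  ultimately have "x t - y t = 0"
    using continuous_constant_on_closure[where f = "\<lambda>t. x t - y t" and S = "{0..<1}" and a = 0 and x = t]
      before_1 by simp
  then show ?thesis by simp
qed

end

section \<open>Measurable dependence on the path\<close>

text \<open>
  Joint measurability by discretising time downwards: at time \<open>s\<close> only the value at the last grid point up to \<open>s\<close> is
  used, so nothing after \<open>t\<close> is needed. Clamping to \<open>[0, t]\<close> makes the approximation total.
\<close>

lemma measurable_continuous_process:
  fixes X :: "real \<Rightarrow> 'a \<Rightarrow> real"
  assumes X: "\<And>s. s \<in> {0..t} \<Longrightarrow> X s \<in> borel_measurable N"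
    and cont: "\<And>\<omega>. \<omega> \<in> space N \<Longrightarrow> continuous_on {0..t} (\<lambda>s. X s \<omega>)"
    and "0 \<le> t"
  shows "(\<lambda>p. X (max 0 (min t (snd p))) (fst p)) \<in> borel_measurable (N \<Otimes>\<^sub>M lborel)"
proof (rule borel_measurable_LIMSEQ_real)
  define r where "r n s = max 0 (min t (of_int \<lfloor>real (Suc n) * s\<rfloor> / real (Suc n)))" for n s
  have r_in: "r n s \<in> {0..t}" for n s using \<open>0 \<le> t\<close> by (auto simp: r_def)
  show "(\<lambda>p. X (r n (snd p)) (fst p)) \<in> borel_measurable (N \<Otimes>\<^sub>M lborel)" for n
  proof -
    have "(\<lambda>p. X (max 0 (min t (of_int i / real (Suc n)))) (fst p)) \<in> borel_measurable (N \<Otimes>\<^sub>M lborel)" for i :: int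
      by (rule measurable_compose[OF measurable_fst X]) (use \<open>0 \<le> t\<close> in auto)
    from measurable_compose_countable[where g = "\<lambda>p. \<lfloor>real (Suc n) * snd p\<rfloor>", OF this]
    show ?thesis unfolding r_def by measurable
  qed
  fix p assume p: "p \<in> space (N \<Otimes>\<^sub>M (lborel :: real measure))"
  let ?s = "snd p"
  have "(\<lambda>n. of_int \<lfloor>real (Suc n) * ?s\<rfloor> / real (Suc n)) \<longlonglongrightarrow> ?s"
  proof (rule tendsto_sandwich[of "\<lambda>n. ?s - 1 / real (Suc n)" _ _ "\<lambda>n. ?s"])
    show "(\<lambda>n. ?s - 1 / real (Suc n)) \<longlonglongrightarrow> ?s"
      using tendsto_diff[OF tendsto_const LIMSEQ_inverse_real_of_nat, of ?s] by (simp add: inverse_eq_divide)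
    have "(real (Suc n) * ?s - 1) / real (Suc n) \<le> of_int \<lfloor>real (Suc n) * ?s\<rfloor> / real (Suc n)"
      "of_int \<lfloor>real (Suc n) * ?s\<rfloor> / real (Suc n) \<le> (real (Suc n) * ?s) / real (Suc n)" for n
      by (rule divide_right_mono; linarith)+
    then show "\<forall>\<^sub>F n in sequentially. ?s - 1 / real (Suc n) \<le> of_int \<lfloor>real (Suc n) * ?s\<rfloor> / real (Suc n)"
      "\<forall>\<^sub>F n in sequentially. of_int \<lfloor>real (Suc n) * ?s\<rfloor> / real (Suc n) \<le> ?s"
      by (simp_all add: diff_divide_distrib del: of_nat_Suc)
  qed simp
  then have lim: "(\<lambda>n. r n ?s) \<longlonglongrightarrow> max 0 (min t ?s)"
    unfolding r_def by (intro tendsto_intros)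
  have "continuous_on {0..t} (\<lambda>s. X s (fst p))"
    using p by (intro cont) (auto simp: space_pair_measure)
  then show "(\<lambda>n. X (r n ?s) (fst p)) \<longlonglongrightarrow> X (max 0 (min t ?s)) (fst p)"
    by (rule continuous_on_tendsto_compose[OF _ lim]) (use r_in \<open>0 \<le> t\<close> in auto)
qed

text \<open>
  This gives adaptedness of time integrals: if \<open>N\<close> is the \<open>\<sigma>\<close>-algebra at time \<open>t\<close>, the integral up to time \<open>t\<close> is
  measurable with respect to it. As \<open>f\<close> is given on \<open>[0, 1)\<close> only, it is extended by \<open>0\<close>.
\<close>

lemma measurable_path_integral:
  fixes X :: "real \<Rightarrow> 'a \<Rightarrow> real" and f :: "real \<Rightarrow> real \<Rightarrow> real"
  assumes f: "continuous_on ({0..<1} \<times> UNIV) (\<lambda>(s, y). f s y)"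
    and X: "\<And>s. s \<in> {0..t} \<Longrightarrow> X s \<in> borel_measurable N"
    and cont: "\<And>\<omega>. \<omega> \<in> space N \<Longrightarrow> continuous_on {0..t} (\<lambda>s. X s \<omega>)"
    and t: "t \<in> {0..1}"
  shows "(\<lambda>\<omega>. LINT s:{0..<t}|lborel. f s (X s \<omega>)) \<in> borel_measurable N"
proof -
  let ?\<phi> = "\<lambda>p. indicator ({0..<1} \<times> UNIV) p *\<^sub>R (case p of (s, y) \<Rightarrow> f s y)"
  have "{0..<1::real} \<times> (UNIV :: real set) \<in> sets borel"
    by (intro borel_Times) auto
  then have \<phi>: "?\<phi> \<in> borel_measurable borel"
    by (rule borel_measurable_continuous_on_indicator[OF _ f])
  have path: "(\<lambda>p. X (max 0 (min t (snd p))) (fst p)) \<in> borel_measurable (N \<Otimes>\<^sub>M lborel)"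
    by (rule measurable_continuous_process[OF X cont]) (use t in auto)
  have "(\<lambda>p. (snd p, X (max 0 (min t (snd p))) (fst p))) \<in> borel_measurable (N \<Otimes>\<^sub>M lborel)"
    by (rule borel_measurable_Pair[OF _ path]) simp
  from measurable_compose[OF this \<phi>]
  have "(\<lambda>p. ?\<phi> (snd p, X (max 0 (min t (snd p))) (fst p))) \<in> borel_measurable (N \<Otimes>\<^sub>M lborel)" .
  then have "(\<lambda>p. indicator {0..<t} (snd p) *\<^sub>R ?\<phi> (snd p, X (max 0 (min t (snd p))) (fst p)))
      \<in> borel_measurable (N \<Otimes>\<^sub>M lborel)"
    by measurable
  also have "(\<lambda>p. indicator {0..<t} (snd p) *\<^sub>R ?\<phi> (snd p, X (max 0 (min t (snd p))) (fst p)))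
      = (\<lambda>(\<omega>, s). indicator {0..<t} s *\<^sub>R f s (X s \<omega>))"
    using t by (auto simp: fun_eq_iff indicator_def)
  finally show ?thesis
    unfolding set_lebesgue_integral_def by (rule lborel.borel_measurable_lebesgue_integral)
qed

context restoring_drift
begin

lemma drift_cont: "continuous_on ({0..<1} \<times> UNIV) (\<lambda>(s, y). y * g s y)"
  using continuous_on_mult[OF continuous_on_snd[OF continuous_on_id] g_cont]
  by (simp add: case_prod_beta)

lemma measurable_picard:
  assumes w: "\<And>s. s \<in> {0..t} \<Longrightarrow> (\<lambda>\<omega>. w \<omega> s) \<in> borel_measurable N"
    and cont: "\<And>\<omega>. \<omega> \<in> space N \<Longrightarrow> continuous_on {0..1} (w \<omega>)"
    and t: "t \<in> {0..1}"
  shows "(\<lambda>\<omega>. picard (w \<omega>) m t) \<in> borel_measurable N"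
  using w t
proof (induction m arbitrary: t)
  case 0
  then show ?case by simp
next
  case (Suc m)
  have "(\<lambda>\<omega>. LINT s:{0..<t}|lborel. picard (w \<omega>) m s * g s (picard (w \<omega>) m s)) \<in> borel_measurable N"
  proof (rule measurable_path_integral[OF drift_cont])
    show "(\<lambda>\<omega>. picard (w \<omega>) m s) \<in> borel_measurable N" if "s \<in> {0..t}" for s
      using Suc.prems that by (intro Suc.IH) auto
    show "continuous_on {0..t} (\<lambda>s. picard (w \<omega>) m s)" if "\<omega> \<in> space N" for \<omega>
      by (rule continuous_on_subset[OF continuous_on_picard[OF cont[OF that]]]) (use Suc.prems in auto)
  qed fact
  with Suc.prems show ?case by simp
qed

lemma measurable_solution:
  assumes w: "\<And>s. s \<in> {0..t} \<Longrightarrow> (\<lambda>\<omega>. w \<omega> s) \<in> borel_measurable N"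
    and cont: "\<And>\<omega>. \<omega> \<in> space N \<Longrightarrow> continuous_on {0..1} (w \<omega>)"
    and t: "t \<in> {0..1}"
  shows "(\<lambda>\<omega>. solution (w \<omega>) t) \<in> borel_measurable N"
  by (rule borel_measurable_LIMSEQ_real[OF picard_tendsto_solution measurable_picard])
    (use assms in auto)

end

section \<open>The integrating factor\<close>

lemma exp_minus_linear_bounds:
  fixes x :: real
  assumes "0 \<le> x"
  shows "0 \<le> exp x - 1 - x" "exp x - 1 - x \<le> x\<^sup>2 * exp x"
proof -
  show "0 \<le> exp x - 1 - x" using exp_ge_add_one_self[of x] by linarith
  have "(1 - x) * exp x \<le> exp (- x) * exp x"
    using exp_ge_add_one_self[of "- x"] by (intro mult_right_mono) auto
  then have *: "exp x - 1 \<le> x * exp x" by (simp add: exp_minus algebra_simps)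
  then have "exp x - 1 - x \<le> x * (exp x - 1)" by (simp add: algebra_simps)
  also have "\<dots> \<le> x * (x * exp x)" using * assms by (intro mult_left_mono)
  finally show "exp x - 1 - x \<le> x\<^sup>2 * exp x" by (simp add: power2_eq_square mult_ac)
qed

context restoring_drift
begin

text \<open>
  The logarithm of the integrating factor along the path \<open>y\<close>.
\<close>

definition total_rate :: "(real \<Rightarrow> real) \<Rightarrow> real \<Rightarrow> real" where
  "total_rate y t = (LINT s:{0..<t}|lborel. g s (y s))"

lemma total_rate_0 [simp]: "total_rate y 0 = 0"
  by (simp add: total_rate_def set_lebesgue_integral_def)

lemma continuous_on_total_rate:
  "continuous_on {0..1} y \<Longrightarrow> continuous_on {0..1} (total_rate y)"
  unfolding total_rate_def[abs_def] by (intro continuous_on_set_integral g_path_integrable)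

lemma total_rate_increment:
  assumes "continuous_on {0..1} y" "0 \<le> s" "s \<le> t" "t \<le> 1"
  shows "total_rate y t - total_rate y s = (LINT r:{s..<t}|lborel. g r (y r))"
  unfolding total_rate_def
  by (rule set_integral_half_open_split) (use assms g_path_integrable in auto)

lemma total_rate_mono:
  assumes "continuous_on {0..1} y" "0 \<le> s" "s \<le> t" "t \<le> 1"
  shows "total_rate y s \<le> total_rate y t"
proof -
  have "0 \<le> (LINT r:{s..<t}|lborel. g r (y r))"
    unfolding set_lebesgue_integral_def
    by (rule integral_nonneg_AE) (use g_nonneg assms in \<open>auto simp: indicator_def\<close>)
  with total_rate_increment[OF assms] show ?thesis by simp
qed

lemma total_rate_bounds:
  assumes "continuous_on {0..1} y" "t \<in> {0..1}"
  shows "0 \<le> total_rate y t" "total_rate y t \<le> 2 * q"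
  using g_integral_bounds[OF assms] by (simp_all add: total_rate_def)

text \<open>
  One step of the discrete product rule. Write \<open>\<Delta>\<close> for the increment of the rate. The error has two sources:
  \<open>exp \<Delta> - 1\<close> is replaced by \<open>\<Delta>\<close>, which costs \<open>O(\<Delta>\<^sup>2)\<close>, and \<open>y\<close> is frozen at the right end in the drift
  integral, which costs the oscillation of \<open>y\<close> times \<open>\<Delta>\<close>. Both are at most \<open>\<epsilon> \<Delta>\<close> up to constants, so the errors
  of all steps add up to \<open>O(\<epsilon>)\<close>.
\<close>

lemma integrating_factor_step:
  assumes y: "continuous_on {0..1} y"
    "\<And>t. t \<in> {0..1} \<Longrightarrow> y t = w t - (LINT s:{0..<t}|lborel. y s * g s (y s))"
    and st: "0 \<le> s" "s \<le> t" "t \<le> 1"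
    and \<epsilon>: "\<And>r. r \<in> {s..t} \<Longrightarrow> \<bar>y r - y t\<bar> \<le> \<epsilon>" "total_rate y t - total_rate y s \<le> \<epsilon>"
    and R: "\<bar>y t\<bar> \<le> R"
  shows "\<bar>exp (total_rate y t) * y t - exp (total_rate y s) * y s
      - exp (total_rate y s) * (w t - w s)\<bar>
    \<le> (R + 1) * exp (2 * q) * \<epsilon> * (total_rate y t - total_rate y s)"
proof -
  let ?G = "total_rate y"
  define \<Delta> where "\<Delta> = ?G t - ?G s"
  define I where "I = (LINT r:{s..<t}|lborel. y r * g r (y r))"
  have \<Delta>: "0 \<le> \<Delta>" "\<Delta> \<le> \<epsilon>"
    using total_rate_mono[OF y(1) st] \<epsilon>(2) by (auto simp: \<Delta>_def)
  have R0: "0 \<le> R" using R by linarith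
  have incr: "y t - y s = (w t - w s) - I"
    using set_integral_half_open_split[OF drift_path_integrable[OF y(1)] st] y(2)[of t] y(2)[of s] st
    by (simp add: I_def)
  have ig: "set_integrable lborel {s..<t} (\<lambda>r. g r (y r))"
    by (rule set_integrable_subset[OF g_path_integrable[OF y(1)]]) (use st in auto)
  have iyg: "set_integrable lborel {s..<t} (\<lambda>r. y r * g r (y r))"
    by (rule set_integrable_subset[OF drift_path_integrable[OF y(1)]]) (use st in auto)
  note d = set_integral_diff[OF set_integrable_mult_right[OF ig, of "y t"] iyg]
  have "y t * \<Delta> - I = (LINT r:{s..<t}|lborel. y t * g r (y r) - y r * g r (y r))"
    unfolding d(2) \<Delta>_def total_rate_increment[OF y(1) st] I_def by simp
  also have "\<bar>\<dots>\<bar> \<le> (LINT r:{s..<t}|lborel. \<bar>y t * g r (y r) - y r * g r (y r)\<bar>)"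
    using set_integral_norm_bound[OF d(1)] by simp
  also have "\<dots> \<le> (LINT r:{s..<t}|lborel. \<epsilon> * g r (y r))"
  proof (intro set_integral_mono set_integrable_abs d(1) set_integrable_mult_right ig)
    fix r assume r: "r \<in> {s..<t}"
    have "\<bar>y t * g r (y r) - y r * g r (y r)\<bar> = \<bar>y r - y t\<bar> * g r (y r)"
      using g_nonneg[of r] r st by (simp add: left_diff_distrib[symmetric] abs_mult abs_minus_commute)
    also have "\<dots> \<le> \<epsilon> * g r (y r)"
      using \<epsilon>(1)[of r] r g_nonneg[of r] st by (intro mult_right_mono) auto
    finally show "\<bar>y t * g r (y r) - y r * g r (y r)\<bar> \<le> \<epsilon> * g r (y r)" .
  qed
  also have "\<dots> = \<epsilon> * \<Delta>"
    unfolding \<Delta>_def total_rate_increment[OF y(1) st] by simp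
  finally have I: "\<bar>y t * \<Delta> - I\<bar> \<le> \<epsilon> * \<Delta>" .
  have Gs: "exp (?G s) \<le> exp (2 * q)"
    using total_rate_bounds(2)[OF y(1), of s] st by simp
  have Gt: "exp (?G t) = exp (?G s) * exp \<Delta>" "exp (?G t) \<le> exp (2 * q)"
    using total_rate_bounds(2)[OF y(1), of t] st by (simp_all add: \<Delta>_def exp_add[symmetric])
  have E: "\<bar>exp (?G s) * (exp \<Delta> - 1 - \<Delta>)\<bar> \<le> exp (2 * q) * (\<epsilon> * \<Delta>)"
  proof -
    have "\<bar>exp (?G s) * (exp \<Delta> - 1 - \<Delta>)\<bar> = exp (?G s) * (exp \<Delta> - 1 - \<Delta>)"
      using exp_minus_linear_bounds(1)[OF \<Delta>(1)] by (simp add: abs_mult)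
    also have "\<dots> \<le> exp (?G s) * (\<Delta>\<^sup>2 * exp \<Delta>)"
      using exp_minus_linear_bounds(2)[OF \<Delta>(1)] by (intro mult_left_mono) auto
    also have "\<dots> = exp (?G t) * (\<Delta> * \<Delta>)" by (simp add: Gt power2_eq_square mult_ac)
    also have "\<dots> \<le> exp (2 * q) * (\<epsilon> * \<Delta>)"
      using \<Delta> Gt(2) by (intro mult_mono) auto
    finally show ?thesis .
  qed
  have "exp (?G t) * y t - exp (?G s) * y s - exp (?G s) * (w t - w s)
      = exp (?G s) * (exp \<Delta> - 1 - \<Delta>) * y t + exp (?G s) * (y t * \<Delta> - I)"
    using incr unfolding Gt(1) by (simp add: algebra_simps) algebra
  also have "\<bar>\<dots>\<bar> \<le> \<bar>exp (?G s) * (exp \<Delta> - 1 - \<Delta>)\<bar> * \<bar>y t\<bar> + exp (?G s) * \<bar>y t * \<Delta> - I\<bar>"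
    by (rule order_trans[OF abs_triangle_ineq]) (simp add: abs_mult)
  also have "\<dots> \<le> exp (2 * q) * (\<epsilon> * \<Delta>) * R + exp (2 * q) * (\<epsilon> * \<Delta>)"
    using E I R Gs \<Delta> by (intro add_mono mult_mono) auto
  finally show ?thesis by (simp add: \<Delta>_def algebra_simps)
qed

text \<open>
  The pathwise form of \<open>exp G(1) Y\<^sub>1 = \<integral> exp G dw\<close>. The path \<open>w\<close> may have unbounded variation; the Riemann sums
  converge because \<open>exp G\<close> is monotone and continuous.
\<close>

lemma integrating_factor_limit:
  assumes y: "continuous_on {0..1} y"
    "\<And>t. t \<in> {0..1} \<Longrightarrow> y t = w t - (LINT s:{0..<t}|lborel. y s * g s (y s))"
    and "y 0 = 0"
  shows "(\<lambda>n. \<Sum>i<Suc n. exp (total_rate y (i / Suc n)) * (w (Suc i / Suc n) - w (i / Suc n)))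
    \<longlonglongrightarrow> exp (total_rate y 1) * y 1"
proof -
  let ?G = "total_rate y"
  let ?S = "\<lambda>n. \<Sum>i<Suc n. exp (?G (i / Suc n)) * (w (Suc i / Suc n) - w (i / Suc n))"
  obtain R where R: "0 \<le> R" "\<And>s. s \<in> {0..1} \<Longrightarrow> \<bar>y s\<bar> \<le> R"
    using bounded_path[OF y(1)] by blast
  \<comment> \<open>The step errors sum to \<open>(K - 1) \<epsilon>\<close>; the extra \<open>1\<close> makes \<open>K\<close> positive and the final estimate strict.\<close>
  define K where "K = (R + 1) * exp (2 * q) * (2 * q) + 1"
  have K: "0 < K" using R q_nonneg by (auto simp: K_def intro!: add_nonneg_pos)
  have uc: "uniformly_continuous_on {0..1} y" "uniformly_continuous_on {0..1} ?G"
    by (intro compact_uniformly_continuous y continuous_on_total_rate compact_Icc)+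
  show ?thesis
  proof (rule LIMSEQ_I)
    fix e :: real assume "0 < e"
    define \<epsilon> where "\<epsilon> = e / K"
    have \<epsilon>: "0 < \<epsilon>" using \<open>0 < e\<close> K by (simp add: \<epsilon>_def)
    obtain d1 where d1: "0 < d1" "\<And>r s. r \<in> {0..1} \<Longrightarrow> s \<in> {0..1} \<Longrightarrow> \<bar>r - s\<bar> < d1 \<Longrightarrow> \<bar>y r - y s\<bar> < \<epsilon>"
      using uc(1)[unfolded uniformly_continuous_on_def, rule_format, OF \<epsilon>] by (auto simp: dist_real_def)
    obtain d2 where d2: "0 < d2" "\<And>r s. r \<in> {0..1} \<Longrightarrow> s \<in> {0..1} \<Longrightarrow> \<bar>r - s\<bar> < d2 \<Longrightarrow> \<bar>?G r - ?G s\<bar> < \<epsilon>"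
      using uc(2)[unfolded uniformly_continuous_on_def, rule_format, OF \<epsilon>] by (auto simp: dist_real_def)
    obtain N :: nat where N: "inverse (real (Suc N)) < min d1 d2"
      using reals_Archimedean[of "min d1 d2"] d1(1) d2(1) by auto
    show "\<exists>N. \<forall>n\<ge>N. norm (?S n - exp (?G 1) * y 1) < e"
    proof (intro exI allI impI)
      fix n assume "N \<le> n"
      define \<tau> where "\<tau> i = real i / real (Suc n)" for i
      have mesh: "\<tau> (Suc i) - \<tau> i < min d1 d2" for i
      proof -
        have "\<tau> (Suc i) - \<tau> i = inverse (real (Suc n))"
          by (simp add: \<tau>_def diff_divide_distrib[symmetric] inverse_eq_divide del: of_nat_Suc)
        also have "\<dots> \<le> inverse (real (Suc N))"
          using \<open>N \<le> n\<close> by (intro le_imp_inverse_le) auto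
        finally show ?thesis using N by linarith
      qed
      have \<tau>: "0 \<le> \<tau> i" "\<tau> i \<le> \<tau> (Suc i)" for i
        by (simp_all add: \<tau>_def divide_right_mono)
      have \<tau>1: "\<tau> (Suc i) \<le> 1" if "i < Suc n" for i
        using that by (simp add: \<tau>_def)
      have ends: "\<tau> 0 = 0" "\<tau> (Suc n) = 1" by (simp_all add: \<tau>_def)
      define E where "E i = exp (?G (\<tau> (Suc i))) * y (\<tau> (Suc i)) - exp (?G (\<tau> i)) * y (\<tau> i)
          - exp (?G (\<tau> i)) * (w (\<tau> (Suc i)) - w (\<tau> i))" for i
      have E: "\<bar>E i\<bar> \<le> (R + 1) * exp (2 * q) * \<epsilon> * (?G (\<tau> (Suc i)) - ?G (\<tau> i))" if i: "i < Suc n" for i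
        unfolding E_def
      proof (rule integrating_factor_step[OF y])
        show "\<bar>y r - y (\<tau> (Suc i))\<bar> \<le> \<epsilon>" if "r \<in> {\<tau> i..\<tau> (Suc i)}" for r
          using d1(2)[of r "\<tau> (Suc i)"] mesh[of i] that \<tau>[of i] \<tau>1[OF i] by auto
        show "?G (\<tau> (Suc i)) - ?G (\<tau> i) \<le> \<epsilon>"
          using d2(2)[of "\<tau> (Suc i)" "\<tau> i"] mesh[of i] \<tau>[of i] \<tau>1[OF i] by auto
        show "\<bar>y (\<tau> (Suc i))\<bar> \<le> R"
          using \<tau>[of i] \<tau>1[OF i] by (intro R) auto
      qed (use \<tau> \<tau>1[OF i] in auto)
      have S: "?S n = (\<Sum>i<Suc n. exp (?G (\<tau> i)) * (w (\<tau> (Suc i)) - w (\<tau> i)))"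
        by (simp only: \<tau>_def)
      have "(\<Sum>i<Suc n. E i) = exp (?G 1) * y 1 - ?S n"
        using sum_lessThan_telescope[of "\<lambda>i. exp (?G (\<tau> i)) * y (\<tau> i)" "Suc n"] ends \<open>y 0 = 0\<close>
        unfolding E_def S by (simp only: sum_subtractf mult_zero_right diff_0_right)
      then have "\<bar>?S n - exp (?G 1) * y 1\<bar> = \<bar>\<Sum>i<Suc n. E i\<bar>"
        by (simp only: abs_minus_commute)
      also have "\<dots> \<le> (\<Sum>i<Suc n. \<bar>E i\<bar>)" by (rule sum_abs)
      also have "\<dots> \<le> (\<Sum>i<Suc n. (R + 1) * exp (2 * q) * \<epsilon> * (?G (\<tau> (Suc i)) - ?G (\<tau> i)))"
        by (intro sum_mono E) auto
      also have "\<dots> = (R + 1) * exp (2 * q) * \<epsilon> * (?G 1)"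
        using sum_lessThan_telescope[of "\<lambda>i. ?G (\<tau> i)" "Suc n"] ends
        by (simp only: sum_distrib_left[symmetric]) simp
      also have "\<dots> \<le> (R + 1) * exp (2 * q) * \<epsilon> * (2 * q)"
        using total_rate_bounds(2)[OF y(1), of 1] R \<epsilon> by (intro mult_left_mono) auto
      also have "\<dots> = (K - 1) * \<epsilon>" by (simp add: K_def)
      also have "\<dots> < K * \<epsilon>" using \<epsilon> by simp
      also have "\<dots> = e" using K by (simp add: \<epsilon>_def)
      finally show "norm (?S n - exp (?G 1) * y 1) < e" by simp
    qed
  qed
qed

end

section \<open>Restoring drifts from functions of class C12\<close>

text \<open>
  The local Lipschitz bound is the mean value theorem: the derivative \<open>c (H\<^sub>y + y H\<^sub>y\<^sub>y)\<close> of the drift in \<open>y\<close> is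
  continuous, hence bounded on the compact rectangle \<open>[0, T] \<times> [-R, R]\<close>.
\<close>

lemma restoring_drift_C12:
  assumes H: "C12_on {0..<1} H"
    and bounds: "\<And>t y. t \<in> {0..<1} \<Longrightarrow>
      0 \<le> deriv (H t) y \<and> deriv (H t) y \<le> C * (1 / sqrt (1 - t))"
    and "0 \<le> c"
  shows "restoring_drift (\<lambda>t y. c * deriv (H t) y) (c * C)"
proof
  obtain Ht Hy Hyy where D:
    "\<And>t y. t \<in> {0..<1} \<Longrightarrow> (H t has_real_derivative Hy t y) (at y)"
    "\<And>t y. t \<in> {0..<1} \<Longrightarrow> (Hy t has_real_derivative Hyy t y) (at y)"
    and cont: "continuous_on ({0..<1} \<times> UNIV) (\<lambda>(t, y). Hy t y)"
    "continuous_on ({0..<1} \<times> UNIV) (\<lambda>(t, y). Hyy t y)"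
    using H unfolding C12_on_def by blast
  have deriv: "deriv (H t) = Hy t" if "t \<in> {0..<1}" for t
    using D(1)[OF that] by (auto intro!: DERIV_imp_deriv)
  show "continuous_on ({0..<1} \<times> UNIV) (\<lambda>(s, y). c * deriv (H s) y)"
    using continuous_on_mult[OF continuous_on_const cont(1), of c]
    by (rule continuous_on_eq) (auto simp: deriv)
  show "0 \<le> c * deriv (H s) y" if "s \<in> {0..<1}" for s y
    using bounds[OF that] \<open>0 \<le> c\<close> by simp
  show "c * deriv (H s) y \<le> c * C / sqrt (1 - s)" if "s \<in> {0..<1}" for s y
    using mult_left_mono[of "deriv (H s) y" "C * (1 / sqrt (1 - s))" c] bounds[OF that] \<open>0 \<le> c\<close> by simp
  fix T R :: real
  assume "T < 1"
  let ?D = "\<lambda>(t, y). c * (Hy t y + y * Hyy t y)"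
  have sub: "{0..T} \<times> {-R..R} \<subseteq> {0..<1} \<times> UNIV" using \<open>T < 1\<close> by auto
  have "continuous_on ({0..T} \<times> {-R..R}) (\<lambda>p. c * ((case p of (t, y) \<Rightarrow> Hy t y) + snd p * (case p of (t, y) \<Rightarrow> Hyy t y)))"
    by (intro continuous_intros continuous_on_subset[OF cont(1) sub] continuous_on_subset[OF cont(2) sub])
  then have "continuous_on ({0..T} \<times> {-R..R}) ?D"
    by (rule continuous_on_eq) auto
  then have "compact (?D ` ({0..T} \<times> {-R..R}))"
    by (intro compact_continuous_image compact_Times compact_Icc)
  then have "bounded (?D ` ({0..T} \<times> {-R..R}))" by (rule compact_imp_bounded)
  then obtain L where L: "\<forall>x \<in> ?D ` ({0..T} \<times> {-R..R}). norm x \<le> L"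
    unfolding bounded_iff by blast
  have "\<bar>x * (c * deriv (H s) x) - y * (c * deriv (H s) y)\<bar> \<le> L * \<bar>x - y\<bar>"
    if s: "s \<in> {0..T}" and xy: "\<bar>x\<bar> \<le> R" "\<bar>y\<bar> \<le> R" for s x y
  proof -
    have s1: "s \<in> {0..<1}" using s \<open>T < 1\<close> by auto
    have "norm ((\<lambda>z. z * (c * Hy s z)) x - (\<lambda>z. z * (c * Hy s z)) y) \<le> L * norm (x - y)"
    proof (rule field_differentiable_bound[of "{-R..R}"])
      fix z assume z: "z \<in> {-R..R}"
      have "((\<lambda>z. z * (c * Hy s z)) has_real_derivative c * (Hy s z + z * Hyy s z)) (at z)"
        by (rule derivative_eq_intros D(2)[OF s1] refl)+ (simp add: algebra_simps)
      then show "((\<lambda>z. z * (c * Hy s z)) has_field_derivative c * (Hy s z + z * Hyy s z)) (at z within {-R..R})"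
        by (rule has_field_derivative_at_within)
      have "?D (s, z) \<in> ?D ` ({0..T} \<times> {-R..R})"
        by (rule imageI) (use s z in auto)
      from bspec[OF L this] show "norm (c * (Hy s z + z * Hyy s z)) \<le> L"
        by simp
    qed (use xy in auto)
    then show ?thesis by (simp add: deriv[OF s1])
  qed
  then show "\<exists>L. \<forall>s\<in>{0..T}. \<forall>x y. \<bar>x\<bar> \<le> R \<longrightarrow> \<bar>y\<bar> \<le> R \<longrightarrow>
      \<bar>x * (c * deriv (H s) x) - y * (c * deriv (H s) y)\<bar> \<le> L * \<bar>x - y\<bar>"
    by blast
qed

section \<open>Convex comparison for sums against Brownian increments\<close>

text \<open>
  The property of convex functions that drives the comparison: moving two symmetric points apart
  increases the sum of the values. Unlike convexity it makes sense verbatim for functions into the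
  extended nonnegative reals, and it survives averaging without any integrability condition.
\<close>

definition spread_monotone :: "(real \<Rightarrow> ennreal) \<Rightarrow> bool" where
  "spread_monotone \<phi> \<longleftrightarrow> (\<forall>x h k. \<bar>h\<bar> \<le> \<bar>k\<bar> \<longrightarrow> \<phi> (x + h) + \<phi> (x - h) \<le> \<phi> (x + k) + \<phi> (x - k))"

lemma spread_monotone_square: "spread_monotone (\<lambda>x. ennreal (x\<^sup>2))"
proof -
  have "(x + h)\<^sup>2 + (x - h)\<^sup>2 \<le> (x + k)\<^sup>2 + (x - k)\<^sup>2" if "\<bar>h\<bar> \<le> \<bar>k\<bar>" for x h k :: real
    using abs_le_square_iff[THEN iffD1, OF that] by (simp add: power2_eq_square algebra_simps)
  then show ?thesis
    unfolding spread_monotone_def by (simp flip: ennreal_plus)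
qed

lemma spread_monotone_positive_part: "spread_monotone (\<lambda>x. ennreal (max (a * x - b) 0))"
  unfolding spread_monotone_def
proof (intro allI impI)
  fix x h k :: real
  assume "\<bar>h\<bar> \<le> \<bar>k\<bar>"
  then have "\<bar>a * h\<bar> \<le> \<bar>a * k\<bar>" by (simp add: abs_mult mult_left_mono)
  then have "max (a * x + a * h - b) 0 + max (a * x - a * h - b) 0
      \<le> max (a * x + a * k - b) 0 + max (a * x - a * k - b) 0"
    by (auto simp: max_def abs_if split: if_splits)
  moreover have "ennreal (max p 0) + ennreal (max r 0) = ennreal (max p 0 + max r 0)" for p r :: real
    by (rule ennreal_plus[symmetric]) auto
  ultimately show "ennreal (max (a * (x + h) - b) 0) + ennreal (max (a * (x - h) - b) 0)
      \<le> ennreal (max (a * (x + k) - b) 0) + ennreal (max (a * (x - k) - b) 0)"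
    by (simp only: distrib_left right_diff_distrib ennreal_leI)
qed

definition centered_normal :: "real \<Rightarrow> real measure" where
  "centered_normal v = density lborel (normal_density 0 (sqrt v))"

lemma sets_centered_normal [measurable_cong, simp]: "sets (centered_normal v) = sets borel"
  by (simp add: centered_normal_def)

lemma prob_space_centered_normal: "0 < v \<Longrightarrow> prob_space (centered_normal v)"
  unfolding centered_normal_def by (rule prob_space_normal_density) simp

lemma nn_integral_centered_normal_uminus:
  assumes [measurable]: "f \<in> borel_measurable borel"
  shows "(\<integral>\<^sup>+z. f (- z) \<partial>centered_normal v) = (\<integral>\<^sup>+z. f z \<partial>centered_normal v)"
proof -
  have "(\<integral>\<^sup>+z. f z \<partial>centered_normal v) = (\<integral>\<^sup>+z. ennreal (normal_density 0 (sqrt v) z) * f z \<partial>lborel)"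
    unfolding centered_normal_def by (simp add: nn_integral_density)
  also have "\<dots> = (\<integral>\<^sup>+z. ennreal (normal_density 0 (sqrt v) (- z)) * f (- z) \<partial>lborel)"
    by (subst nn_integral_real_affine[of _ "-1" 0]) simp_all
  also have "\<dots> = (\<integral>\<^sup>+z. ennreal (normal_density 0 (sqrt v) z) * f (- z) \<partial>lborel)"
    by (simp add: normal_density_def)
  also have "\<dots> = (\<integral>\<^sup>+z. f (- z) \<partial>centered_normal v)"
    unfolding centered_normal_def by (simp add: nn_integral_density)
  finally show ?thesis by simp
qed

text \<open>
  The law is symmetric, so twice the integral is the integral of the sum over the two points
  \<open>x + c z\<close> and \<open>x - c z\<close>, and the assumption applies for each \<open>z\<close>.
\<close>

lemma nn_integral_spread_mono:
  assumes \<phi>: "spread_monotone \<phi>" and [measurable]: "\<phi> \<in> borel_measurable borel"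
    and ab: "\<bar>a\<bar> \<le> \<bar>b\<bar>"
  shows "(\<integral>\<^sup>+z. \<phi> (x + a * z) \<partial>centered_normal v) \<le> (\<integral>\<^sup>+z. \<phi> (x + b * z) \<partial>centered_normal v)"
proof -
  have twice: "2 * (\<integral>\<^sup>+z. \<phi> (x + c * z) \<partial>centered_normal v)
      = (\<integral>\<^sup>+z. \<phi> (x + c * z) + \<phi> (x - c * z) \<partial>centered_normal v)" for c
    using nn_integral_centered_normal_uminus[of "\<lambda>z. \<phi> (x + c * z)" v]
    by (simp add: nn_integral_add mult_2)
  have "2 * (\<integral>\<^sup>+z. \<phi> (x + a * z) \<partial>centered_normal v) \<le> 2 * (\<integral>\<^sup>+z. \<phi> (x + b * z) \<partial>centered_normal v)"
    unfolding twice
  proof (rule nn_integral_mono)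
    fix z
    have "\<bar>a * z\<bar> \<le> \<bar>b * z\<bar>" using ab by (simp add: abs_mult mult_right_mono)
    then show "\<phi> (x + a * z) + \<phi> (x - a * z) \<le> \<phi> (x + b * z) + \<phi> (x - b * z)"
      using \<phi> by (simp add: spread_monotone_def)
  qed
  then show ?thesis by (subst (asm) ennreal_mult_le_mult_iff) auto
qed

lemma spread_monotone_average:
  assumes \<phi>: "spread_monotone \<phi>" and [measurable]: "\<phi> \<in> borel_measurable borel"
  shows "spread_monotone (\<lambda>x. \<integral>\<^sup>+z. \<phi> (x + a * z) \<partial>centered_normal v)"
  unfolding spread_monotone_def
proof (intro allI impI)
  fix x h k :: real
  assume hk: "\<bar>h\<bar> \<le> \<bar>k\<bar>"
  have "(\<integral>\<^sup>+z. \<phi> (x + h + a * z) + \<phi> (x - h + a * z) \<partial>centered_normal v)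
      \<le> (\<integral>\<^sup>+z. \<phi> (x + k + a * z) + \<phi> (x - k + a * z) \<partial>centered_normal v)"
  proof (rule nn_integral_mono)
    fix z
    have "\<phi> ((x + a * z) + h) + \<phi> ((x + a * z) - h) \<le> \<phi> ((x + a * z) + k) + \<phi> ((x + a * z) - k)"
      using \<phi> hk unfolding spread_monotone_def by blast
    then show "\<phi> (x + h + a * z) + \<phi> (x - h + a * z) \<le> \<phi> (x + k + a * z) + \<phi> (x - k + a * z)"
      by (simp add: algebra_simps)
  qed
  then show "(\<integral>\<^sup>+z. \<phi> (x + h + a * z) \<partial>centered_normal v) + (\<integral>\<^sup>+z. \<phi> (x - h + a * z) \<partial>centered_normal v)
      \<le> (\<integral>\<^sup>+z. \<phi> (x + k + a * z) \<partial>centered_normal v) + (\<integral>\<^sup>+z. \<phi> (x - k + a * z) \<partial>centered_normal v)"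
    by (simp add: nn_integral_add)
qed

lemma measurable_centered_normal_average:
  assumes "0 < v" and [measurable]: "\<phi> \<in> borel_measurable borel"
  shows "(\<lambda>x. \<integral>\<^sup>+z. \<phi> (x + a * z) \<partial>centered_normal v) \<in> borel_measurable borel"
proof -
  interpret prob_space "centered_normal v" by (rule prob_space_centered_normal) fact
  show ?thesis by measurable
qed

context brownian_motion_wrt
begin

lemma measurable_F_imp_M:
  assumes "X \<in> measurable (F t) N" "0 \<le> t"
  shows "X \<in> measurable M N"
  by (rule measurable_mono[THEN subsetD, OF _ _ _ _ assms(1)])
    (use sets_F_subset[OF assms(2)] space_F in auto)

lemma measurable_F_mono:
  assumes "X \<in> measurable (F s) N" "s \<le> t"
  shows "X \<in> measurable (F t) N"
  by (rule measurable_mono[THEN subsetD, OF _ _ _ _ assms(1)])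
    (use sets_F_mono[OF assms(2)] space_F in auto)

lemma measurable_B: "0 \<le> t \<Longrightarrow> B t \<in> borel_measurable M"
  by (rule measurable_F_imp_M[OF adapted])

lemma distr_increment:
  assumes "0 \<le> s" "s < t"
  shows "distr M borel (\<lambda>\<omega>. B t \<omega> - B s \<omega>) = centered_normal (t - s)"
proof -
  have "distr M lborel (\<lambda>\<omega>. B t \<omega> - B s \<omega>) = centered_normal (t - s)"
    using distributed_distr_eq_density[OF normal_increments[OF assms]] by (simp add: centered_normal_def)
  then show ?thesis using distr_cong[OF refl sets_lborel refl, of M] by metis
qed

lemma nn_integral_increment:
  assumes "0 \<le> s" "s < t" and [measurable]: "\<phi> \<in> borel_measurable borel"
  shows "(\<integral>\<^sup>+\<omega>. \<phi> (B t \<omega> - B s \<omega>) \<partial>M) = (\<integral>\<^sup>+z. \<phi> z \<partial>centered_normal (t - s))"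
proof -
  have [measurable]: "B t \<in> borel_measurable M" "B s \<in> borel_measurable M"
    using assms by (auto intro: measurable_B)
  show ?thesis
    by (subst distr_increment[OF assms(1,2), symmetric]) (simp add: nn_integral_distr)
qed

text \<open>
  Freezing: what is known at time \<open>s\<close> can be held fixed while the later increment is averaged out.
  For nonnegative \<open>f\<close> this replaces conditional expectations.
\<close>

lemma nn_integral_independent_increment:
  assumes st: "0 \<le> s" "s < t" and X: "X \<in> measurable (F s) N"
    and f [measurable]: "f \<in> borel_measurable (N \<Otimes>\<^sub>M borel)"
  shows "(\<integral>\<^sup>+\<omega>. f (X \<omega>, B t \<omega> - B s \<omega>) \<partial>M)
    = (\<integral>\<^sup>+\<omega>. (\<integral>\<^sup>+z. f (X \<omega>, z) \<partial>centered_normal (t - s)) \<partial>M)"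
proof -
  let ?Z = "\<lambda>\<omega>. B t \<omega> - B s \<omega>"
  let ?EZ = "{?Z -` A \<inter> space M | A. A \<in> sets borel}"
  have X' [measurable]: "X \<in> measurable M N" by (rule measurable_F_imp_M[OF X st(1)])
  have [measurable]: "B t \<in> borel_measurable M" "B s \<in> borel_measurable M"
    using st by (auto intro: measurable_B)
  have indep: "indep_set (sets (F s)) ?EZ"
    by (rule indep_increments[OF st])
  interpret X: prob_space "distr M N X" by (rule prob_space_distr) simp
  interpret Z: prob_space "distr M borel ?Z" by (rule prob_space_distr) simp
  have joint: "distr M N X \<Otimes>\<^sub>M distr M borel ?Z = distr M (N \<Otimes>\<^sub>M borel) (\<lambda>\<omega>. (X \<omega>, ?Z \<omega>))"
  proof (rule pair_measure_eqI)
    fix A D assume "A \<in> sets (distr M N X)" "D \<in> sets (distr M borel ?Z)"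
    then have [measurable]: "A \<in> sets N" "D \<in> sets borel" by simp_all
    have "X -` A \<inter> space M \<in> sets (F s)"
      using measurable_sets[OF X, of A] space_F[of s] by simp
    then have "prob ((X -` A \<inter> space M) \<inter> (?Z -` D \<inter> space M))
        = prob (X -` A \<inter> space M) * prob (?Z -` D \<inter> space M)"
      by (rule indep_setD[OF indep]) auto
    moreover have "(\<lambda>\<omega>. (X \<omega>, ?Z \<omega>)) -` (A \<times> D) \<inter> space M = (X -` A \<inter> space M) \<inter> (?Z -` D \<inter> space M)"
      by auto
    ultimately show "emeasure (distr M N X) A * emeasure (distr M borel ?Z) D
        = emeasure (distr M (N \<Otimes>\<^sub>M borel) (\<lambda>\<omega>. (X \<omega>, ?Z \<omega>))) (A \<times> D)"
      by (simp add: emeasure_distr emeasure_eq_measure ennreal_mult)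
  qed (auto intro: X.sigma_finite_measure_axioms Z.sigma_finite_measure_axioms sets_pair_measure_cong)
  have "(\<integral>\<^sup>+\<omega>. f (X \<omega>, ?Z \<omega>) \<partial>M) = (\<integral>\<^sup>+p. f p \<partial>distr M (N \<Otimes>\<^sub>M borel) (\<lambda>\<omega>. (X \<omega>, ?Z \<omega>)))"
    by (simp add: nn_integral_distr)
  also have "\<dots> = (\<integral>\<^sup>+x. (\<integral>\<^sup>+z. f (x, z) \<partial>distr M borel ?Z) \<partial>distr M N X)"
    unfolding joint[symmetric]
  proof (rule Z.nn_integral_fst[symmetric])
    show "f \<in> borel_measurable (distr M N X \<Otimes>\<^sub>M distr M borel ?Z)"
      using f measurable_cong_sets[OF sets_pair_measure_cong[OF sets_distr sets_distr] refl] by metis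
  qed
  also have "\<dots> = (\<integral>\<^sup>+\<omega>. (\<integral>\<^sup>+z. f (X \<omega>, z) \<partial>distr M borel ?Z) \<partial>M)"
    by (subst nn_integral_distr) (auto intro!: Z.borel_measurable_nn_integral_fst)
  finally show ?thesis by (simp only: distr_increment[OF st])
qed

definition martingale_transform :: "(nat \<Rightarrow> real) \<Rightarrow> (nat \<Rightarrow> 'a \<Rightarrow> real) \<Rightarrow> nat \<Rightarrow> 'a \<Rightarrow> real" where
  "martingale_transform \<tau> a n \<omega> = (\<Sum>i<n. a i \<omega> * (B (\<tau> (Suc i)) \<omega> - B (\<tau> i) \<omega>))"

lemma measurable_martingale_transform:
  assumes \<tau>: "strict_mono \<tau>" "0 \<le> \<tau> 0" and a: "\<And>i. i < n \<Longrightarrow> a i \<in> borel_measurable (F (\<tau> i))"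
  shows "martingale_transform \<tau> a n \<in> borel_measurable (F (\<tau> n))"
proof -
  have \<tau>0: "0 \<le> \<tau> i" for i
    using \<tau> strict_mono_less_eq[OF \<tau>(1), of 0 i] by simp
  have "a i \<in> borel_measurable (F (\<tau> n))" "B (\<tau> i) \<in> borel_measurable (F (\<tau> n))"
    "B (\<tau> (Suc i)) \<in> borel_measurable (F (\<tau> n))" if "i < n" for i
    using that by (auto intro!: measurable_F_mono[OF a] measurable_F_mono[OF adapted] \<tau>0 simp: strict_mono_less_eq[OF \<tau>(1)])
  then show ?thesis
    unfolding martingale_transform_def[abs_def]
    by (intro borel_measurable_sum borel_measurable_times borel_measurable_diff) auto
qed

lemma nn_integral_martingale_transform_step:
  assumes \<tau>: "strict_mono \<tau>" "0 \<le> \<tau> 0" and a: "\<And>i. i < Suc n \<Longrightarrow> a i \<in> borel_measurable (F (\<tau> i))"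
    and [measurable]: "\<phi> \<in> borel_measurable borel"
  shows "(\<integral>\<^sup>+\<omega>. \<phi> (martingale_transform \<tau> a (Suc n) \<omega>) \<partial>M)
    = (\<integral>\<^sup>+\<omega>. (\<integral>\<^sup>+z. \<phi> (martingale_transform \<tau> a n \<omega> + a n \<omega> * z) \<partial>centered_normal (\<tau> (Suc n) - \<tau> n)) \<partial>M)"
proof -
  have "0 \<le> \<tau> n" "\<tau> n < \<tau> (Suc n)"
    using \<tau> strict_mono_less_eq[OF \<tau>(1), of 0 n] by (auto simp: strict_mono_less)
  moreover have "(\<lambda>\<omega>. (martingale_transform \<tau> a n \<omega>, a n \<omega>)) \<in> measurable (F (\<tau> n)) (borel \<Otimes>\<^sub>M borel)"
    using a by (intro measurable_Pair measurable_martingale_transform \<tau>) auto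
  moreover have "(\<lambda>p. \<phi> (fst (fst p) + snd (fst p) * snd p)) \<in> borel_measurable ((borel \<Otimes>\<^sub>M borel) \<Otimes>\<^sub>M borel)"
    by measurable
  ultimately show ?thesis
    using nn_integral_independent_increment[of "\<tau> n" "\<tau> (Suc n)" "\<lambda>\<omega>. (martingale_transform \<tau> a n \<omega>, a n \<omega>)"
        "borel \<Otimes>\<^sub>M borel" "\<lambda>p. \<phi> (fst (fst p) + snd (fst p) * snd p)"]
    by (simp add: martingale_transform_def)
qed

text \<open>
  Constant weights make the sum telescope; this turns the comparison of two transforms into a
  comparison with Brownian motion itself.
\<close>

lemma martingale_transform_const:
  "martingale_transform \<tau> (\<lambda>i \<omega>. c) n \<omega> = c * (B (\<tau> n) \<omega> - B (\<tau> 0) \<omega>)"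
  unfolding martingale_transform_def sum_distrib_left[symmetric]
  by (subst sum_lessThan_telescope) simp

text \<open>
  Larger weights give a larger spread. In the induction the last increment is averaged out: changing its
  weight to a constant is monotone by \<open>nn_integral_spread_mono\<close>, and what remains is the shorter sum under the averaged
  function, which is again spread-monotone. This is why the statement is proved for all \<open>\<phi>\<close> at once.
\<close>

lemma
  assumes \<tau>: "strict_mono \<tau>" "0 \<le> \<tau> 0"
    and a: "\<And>i. i < n \<Longrightarrow> a i \<in> borel_measurable (F (\<tau> i))"
    and \<phi>: "spread_monotone \<phi>" "\<phi> \<in> borel_measurable borel"
  shows martingale_transform_ge:
    "\<lbrakk>0 \<le> l; \<And>i \<omega>. i < n \<Longrightarrow> \<omega> \<in> space M \<Longrightarrow> l \<le> a i \<omega>\<rbrakk> \<Longrightarrow>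
      (\<integral>\<^sup>+\<omega>. \<phi> (l * (B (\<tau> n) \<omega> - B (\<tau> 0) \<omega>)) \<partial>M) \<le> (\<integral>\<^sup>+\<omega>. \<phi> (martingale_transform \<tau> a n \<omega>) \<partial>M)"
    and martingale_transform_le:
    "(\<And>i \<omega>. i < n \<Longrightarrow> \<omega> \<in> space M \<Longrightarrow> 0 \<le> a i \<omega> \<and> a i \<omega> \<le> u) \<Longrightarrow>
      (\<integral>\<^sup>+\<omega>. \<phi> (martingale_transform \<tau> a n \<omega>) \<partial>M) \<le> (\<integral>\<^sup>+\<omega>. \<phi> (u * (B (\<tau> n) \<omega> - B (\<tau> 0) \<omega>)) \<partial>M)"
proof -
  let ?v = "\<lambda>n. \<tau> (Suc n) - \<tau> n"
  have v: "0 < ?v n" for n using \<tau>(1) by (simp add: strict_mono_less)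
  show "(\<integral>\<^sup>+\<omega>. \<phi> (l * (B (\<tau> n) \<omega> - B (\<tau> 0) \<omega>)) \<partial>M) \<le> (\<integral>\<^sup>+\<omega>. \<phi> (martingale_transform \<tau> a n \<omega>) \<partial>M)"
    if "0 \<le> l" "\<And>i \<omega>. i < n \<Longrightarrow> \<omega> \<in> space M \<Longrightarrow> l \<le> a i \<omega>"
    unfolding martingale_transform_const[symmetric]
    using a that(2) \<phi>
  proof (induction n arbitrary: \<phi>)
    case 0
    then show ?case by (simp add: martingale_transform_def)
  next
    case (Suc n)
    let ?\<psi> = "\<lambda>x. \<integral>\<^sup>+z. \<phi> (x + l * z) \<partial>centered_normal (?v n)"
    have "(\<integral>\<^sup>+\<omega>. \<phi> (martingale_transform \<tau> (\<lambda>i \<omega>. l) (Suc n) \<omega>) \<partial>M)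
        = (\<integral>\<^sup>+\<omega>. ?\<psi> (martingale_transform \<tau> (\<lambda>i \<omega>. l) n \<omega>) \<partial>M)"
      by (rule nn_integral_martingale_transform_step) (use \<tau> Suc in auto)
    also have "\<dots> \<le> (\<integral>\<^sup>+\<omega>. ?\<psi> (martingale_transform \<tau> a n \<omega>) \<partial>M)"
      using Suc.prems by (intro Suc.IH spread_monotone_average measurable_centered_normal_average v) auto
    also have "\<dots> \<le> (\<integral>\<^sup>+\<omega>. (\<integral>\<^sup>+z. \<phi> (martingale_transform \<tau> a n \<omega> + a n \<omega> * z) \<partial>centered_normal (?v n)) \<partial>M)"
      using Suc.prems(2)[of n] \<open>0 \<le> l\<close> by (intro nn_integral_mono nn_integral_spread_mono Suc.prems) fastforce
    also have "\<dots> = (\<integral>\<^sup>+\<omega>. \<phi> (martingale_transform \<tau> a (Suc n) \<omega>) \<partial>M)"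
      by (rule nn_integral_martingale_transform_step[symmetric]) (use \<tau> Suc in auto)
    finally show ?case .
  qed
  show "(\<integral>\<^sup>+\<omega>. \<phi> (martingale_transform \<tau> a n \<omega>) \<partial>M) \<le> (\<integral>\<^sup>+\<omega>. \<phi> (u * (B (\<tau> n) \<omega> - B (\<tau> 0) \<omega>)) \<partial>M)"
    if "\<And>i \<omega>. i < n \<Longrightarrow> \<omega> \<in> space M \<Longrightarrow> 0 \<le> a i \<omega> \<and> a i \<omega> \<le> u"
    unfolding martingale_transform_const[symmetric]
    using a that \<phi>
  proof (induction n arbitrary: \<phi>)
    case 0
    then show ?case by (simp add: martingale_transform_def)
  next
    case (Suc n)
    let ?\<psi> = "\<lambda>x. \<integral>\<^sup>+z. \<phi> (x + u * z) \<partial>centered_normal (?v n)"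
    have "(\<integral>\<^sup>+\<omega>. \<phi> (martingale_transform \<tau> a (Suc n) \<omega>) \<partial>M)
        = (\<integral>\<^sup>+\<omega>. (\<integral>\<^sup>+z. \<phi> (martingale_transform \<tau> a n \<omega> + a n \<omega> * z) \<partial>centered_normal (?v n)) \<partial>M)"
      by (rule nn_integral_martingale_transform_step) (use \<tau> Suc in auto)
    also have "\<dots> \<le> (\<integral>\<^sup>+\<omega>. ?\<psi> (martingale_transform \<tau> a n \<omega>) \<partial>M)"
      using Suc.prems(2)[of n] by (intro nn_integral_mono nn_integral_spread_mono Suc.prems) fastforce
    also have "\<dots> \<le> (\<integral>\<^sup>+\<omega>. ?\<psi> (martingale_transform \<tau> (\<lambda>i \<omega>. u) n \<omega>) \<partial>M)"
      using Suc.prems by (intro Suc.IH spread_monotone_average measurable_centered_normal_average v) auto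
    also have "\<dots> = (\<integral>\<^sup>+\<omega>. \<phi> (martingale_transform \<tau> (\<lambda>i \<omega>. u) (Suc n) \<omega>) \<partial>M)"
      by (rule nn_integral_martingale_transform_step[symmetric]) (use \<tau> Suc in auto)
    finally show ?case .
  qed
qed

end

section \<open>Passage to the limit\<close>

context brownian_motion_wrt
begin

lemma nn_integral_square_increment_finite:
  assumes "0 \<le> s" "s < t"
  shows "(\<integral>\<^sup>+\<omega>. ennreal ((u * (B t \<omega> - B s \<omega>))\<^sup>2) \<partial>M) < \<infinity>"
proof -
  have "integrable lborel (\<lambda>x. normal_density 0 (sqrt (t - s)) x * (x - 0) ^ 2)"
    by (intro integrable_normal_moment) (use assms in simp)
  then have int: "integrable lborel (\<lambda>x. u\<^sup>2 * (normal_density 0 (sqrt (t - s)) x * x\<^sup>2))"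
    by simp
  have "(\<integral>\<^sup>+x. ennreal (u\<^sup>2 * (normal_density 0 (sqrt (t - s)) x * x\<^sup>2)) \<partial>lborel) < \<infinity>"
    using int by (subst nn_integral_eq_integral) auto
  also have "(\<integral>\<^sup>+x. ennreal (u\<^sup>2 * (normal_density 0 (sqrt (t - s)) x * x\<^sup>2)) \<partial>lborel)
      = (\<integral>\<^sup>+x. ennreal ((u * x)\<^sup>2) \<partial>centered_normal (t - s))"
    unfolding centered_normal_def
    by (subst nn_integral_density) (auto simp: ennreal_mult[symmetric] power_mult_distrib mult_ac)
  also have "\<dots> = (\<integral>\<^sup>+\<omega>. ennreal ((u * (B t \<omega> - B s \<omega>))\<^sup>2) \<partial>M)"
    by (subst nn_integral_increment[OF assms]) auto
  finally show ?thesis .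
qed

text \<open>
  The comparison passes to almost sure limits \<open>Z\<close> of Riemann sums. The upper comparison, applied to the square,
  bounds the second moments uniformly; Fatou's lemma then gives square integrability of \<open>Z\<close>. A function
  \<open>\<phi>\<close> with \<open>0 \<le> \<phi> x \<le> |x|\<close> differs from its truncation at level \<open>N\<close> by at most \<open>x\<^sup>2 / N\<close>, so the truncation error is small
  uniformly in \<open>n\<close>, while the truncated functions are treated by dominated convergence.
\<close>

lemma
  assumes \<alpha>: "\<And>s. s \<in> {0..1} \<Longrightarrow> \<alpha> s \<in> borel_measurable (F s)"
    and bounds: "\<And>s \<omega>. s \<in> {0..1} \<Longrightarrow> \<omega> \<in> space M \<Longrightarrow> l \<le> \<alpha> s \<omega> \<and> \<alpha> s \<omega> \<le> u" and "0 \<le> l"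
    and Z [measurable]: "Z \<in> borel_measurable M"
    and lim: "AE \<omega> in M. (\<lambda>n. \<Sum>i<Suc n. \<alpha> (i / Suc n) \<omega> * (B (Suc i / Suc n) \<omega> - B (i / Suc n) \<omega>))
      \<longlonglongrightarrow> Z \<omega>"
  shows integrable_square_limit: "integrable M (\<lambda>\<omega>. (Z \<omega>)\<^sup>2)"
    and nn_integral_limit_ge: "\<And>\<phi>. \<lbrakk>spread_monotone (\<lambda>x. ennreal (\<phi> x)); continuous_on UNIV \<phi>;
      \<And>x. 0 \<le> \<phi> x \<and> \<phi> x \<le> \<bar>x\<bar>\<rbrakk> \<Longrightarrow>
      (\<integral>\<^sup>+\<omega>. ennreal (\<phi> (l * (B 1 \<omega> - B 0 \<omega>))) \<partial>M) \<le> (\<integral>\<^sup>+\<omega>. ennreal (\<phi> (Z \<omega>)) \<partial>M)"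
proof -
  define \<tau> where "\<tau> n i = real i / real (Suc n)" for n i
  define X where "X n = martingale_transform (\<tau> n) (\<lambda>i. \<alpha> (\<tau> n i)) (Suc n)" for n
  have \<tau>: "strict_mono (\<tau> n)" "\<tau> n 0 = 0" "\<tau> n (Suc n) = 1" "0 \<le> \<tau> n 0" for n
    by (auto simp: \<tau>_def strict_mono_def divide_strict_right_mono)
  have \<tau>1: "\<tau> n i \<in> {0..1}" if "i < Suc n" for n i
    using that by (auto simp: \<tau>_def)
  have X_meas [measurable]: "X n \<in> borel_measurable M" for n
  proof -
    have "X n \<in> borel_measurable (F (\<tau> n (Suc n)))"
      unfolding X_def by (intro measurable_martingale_transform \<tau> \<alpha> \<tau>1)
    then show ?thesis by (rule measurable_F_imp_M) (simp add: \<tau>)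
  qed
  have X_lim: "AE \<omega> in M. (\<lambda>n. X n \<omega>) \<longlonglongrightarrow> Z \<omega>"
    using lim unfolding X_def martingale_transform_def \<tau>_def by simp
  have lower: "(\<integral>\<^sup>+\<omega>. \<phi> (l * (B 1 \<omega> - B 0 \<omega>)) \<partial>M) \<le> (\<integral>\<^sup>+\<omega>. \<phi> (X n \<omega>) \<partial>M)"
    if "spread_monotone \<phi>" "\<phi> \<in> borel_measurable borel" for \<phi> n
    using martingale_transform_ge[OF \<tau>(1)[of n] \<tau>(4) _ that \<open>0 \<le> l\<close>, where n = "Suc n" and a = "\<lambda>i. \<alpha> (\<tau> n i)"]
      \<alpha>[OF \<tau>1] bounds[OF \<tau>1] \<tau>(2,3)[of n] by (simp add: X_def)
  have upper: "(\<integral>\<^sup>+\<omega>. \<phi> (X n \<omega>) \<partial>M) \<le> (\<integral>\<^sup>+\<omega>. \<phi> (u * (B 1 \<omega> - B 0 \<omega>)) \<partial>M)"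
    if "spread_monotone \<phi>" "\<phi> \<in> borel_measurable borel" for \<phi> n
    using martingale_transform_le[OF \<tau>(1)[of n] \<tau>(4) _ that, where n = "Suc n" and a = "\<lambda>i. \<alpha> (\<tau> n i)" and u = u]
      \<alpha>[OF \<tau>1] bounds[OF \<tau>1] order_trans[OF \<open>0 \<le> l\<close>] \<tau>(2,3)[of n] by (simp add: X_def)
  define V where "V = (\<integral>\<^sup>+\<omega>. ennreal ((u * (B 1 \<omega> - B 0 \<omega>))\<^sup>2) \<partial>M)"
  have V: "V < \<infinity>" unfolding V_def by (rule nn_integral_square_increment_finite) auto
  have X2: "(\<integral>\<^sup>+\<omega>. ennreal ((X n \<omega>)\<^sup>2) \<partial>M) \<le> V" for n
    unfolding V_def using upper[OF spread_monotone_square] by simp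
  show "integrable M (\<lambda>\<omega>. (Z \<omega>)\<^sup>2)"
  proof -
    have "(\<integral>\<^sup>+\<omega>. ennreal ((Z \<omega>)\<^sup>2) \<partial>M) = (\<integral>\<^sup>+\<omega>. liminf (\<lambda>n. ennreal ((X n \<omega>)\<^sup>2)) \<partial>M)"
    proof (rule nn_integral_cong_AE, use X_lim in eventually_elim)
      fix \<omega> assume "(\<lambda>n. X n \<omega>) \<longlonglongrightarrow> Z \<omega>"
      then have "(\<lambda>n. ennreal ((X n \<omega>)\<^sup>2)) \<longlonglongrightarrow> ennreal ((Z \<omega>)\<^sup>2)"
        by (intro tendsto_ennrealI tendsto_power)
      then show "ennreal ((Z \<omega>)\<^sup>2) = liminf (\<lambda>n. ennreal ((X n \<omega>)\<^sup>2))"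
        by (rule lim_imp_Liminf[OF sequentially_bot, symmetric])
    qed
    also have "\<dots> \<le> liminf (\<lambda>n. \<integral>\<^sup>+\<omega>. ennreal ((X n \<omega>)\<^sup>2) \<partial>M)"
      by (rule nn_integral_liminf) measurable
    also have "\<dots> \<le> limsup (\<lambda>n. \<integral>\<^sup>+\<omega>. ennreal ((X n \<omega>)\<^sup>2) \<partial>M)"
      by (rule Liminf_le_Limsup) simp
    also have "\<dots> \<le> V"
      by (rule Limsup_bounded) (use X2 in auto)
    finally show ?thesis using V by (auto intro!: integrableI_bounded)
  qed
  fix \<phi> :: "real \<Rightarrow> real"
  assume \<phi>: "spread_monotone (\<lambda>x. ennreal (\<phi> x))" "continuous_on UNIV \<phi>" "\<And>x. 0 \<le> \<phi> x \<and> \<phi> x \<le> \<bar>x\<bar>"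
  have [measurable]: "\<phi> \<in> borel_measurable borel"
    by (rule borel_measurable_continuous_onI) fact
  let ?m = "\<integral>\<^sup>+\<omega>. ennreal (\<phi> (l * (B 1 \<omega> - B 0 \<omega>))) \<partial>M"
  have trunc: "?m \<le> (\<integral>\<^sup>+\<omega>. ennreal (\<phi> (Z \<omega>)) \<partial>M) + ennreal (1 / N) * V" if N: "0 < N" for N :: real
  proof -
    have pointwise: "\<phi> x \<le> min (\<phi> x) N + 1 / N * x\<^sup>2" for x
    proof (cases "\<phi> x \<le> N")
      case True
      then show ?thesis using N by simp
    next
      case False
      then have "\<bar>x\<bar> * N \<le> \<bar>x\<bar> * \<bar>x\<bar>" using \<phi>(3)[of x] by (intro mult_left_mono) auto
      then have "\<bar>x\<bar> \<le> 1 / N * x\<^sup>2" using N by (simp add: field_simps power2_eq_square)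
      then show ?thesis using \<phi>(3)[of x] N by (smt (verit))
    qed
    have le: "?m \<le> (\<integral>\<^sup>+\<omega>. ennreal (min (\<phi> (X n \<omega>)) N) \<partial>M) + ennreal (1 / N) * V" for n
    proof -
      have "?m \<le> (\<integral>\<^sup>+\<omega>. ennreal (\<phi> (X n \<omega>)) \<partial>M)"
        by (rule lower[OF \<phi>(1)]) simp
      also have "\<dots> \<le> (\<integral>\<^sup>+\<omega>. ennreal (min (\<phi> (X n \<omega>)) N) + ennreal (1 / N) * ennreal ((X n \<omega>)\<^sup>2) \<partial>M)"
      proof (rule nn_integral_mono)
        fix \<omega>
        have "ennreal (\<phi> (X n \<omega>)) \<le> ennreal (min (\<phi> (X n \<omega>)) N + 1 / N * (X n \<omega>)\<^sup>2)"
          by (rule ennreal_leI) (rule pointwise)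
        also have "\<dots> = ennreal (min (\<phi> (X n \<omega>)) N) + ennreal (1 / N * (X n \<omega>)\<^sup>2)"
          using \<phi>(3)[of "X n \<omega>"] N by (intro ennreal_plus) auto
        also have "ennreal (1 / N * (X n \<omega>)\<^sup>2) = ennreal (1 / N) * ennreal ((X n \<omega>)\<^sup>2)"
          using N by (intro ennreal_mult) auto
        finally show "ennreal (\<phi> (X n \<omega>)) \<le> ennreal (min (\<phi> (X n \<omega>)) N) + ennreal (1 / N) * ennreal ((X n \<omega>)\<^sup>2)" .
      qed
      also have "\<dots> = (\<integral>\<^sup>+\<omega>. ennreal (min (\<phi> (X n \<omega>)) N) \<partial>M) + ennreal (1 / N) * (\<integral>\<^sup>+\<omega>. ennreal ((X n \<omega>)\<^sup>2) \<partial>M)"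
        by (simp add: nn_integral_add nn_integral_cmult)
      also have "\<dots> \<le> (\<integral>\<^sup>+\<omega>. ennreal (min (\<phi> (X n \<omega>)) N) \<partial>M) + ennreal (1 / N) * V"
        by (intro add_left_mono mult_left_mono X2) simp
      finally show ?thesis .
    qed
    have "(\<lambda>n. \<integral>\<^sup>+\<omega>. ennreal (min (\<phi> (X n \<omega>)) N) \<partial>M) \<longlonglongrightarrow> (\<integral>\<^sup>+\<omega>. ennreal (min (\<phi> (Z \<omega>)) N) \<partial>M)"
    proof (rule nn_integral_dominated_convergence[where w = "\<lambda>_. ennreal N"])
      show "AE \<omega> in M. (\<lambda>n. ennreal (min (\<phi> (X n \<omega>)) N)) \<longlonglongrightarrow> ennreal (min (\<phi> (Z \<omega>)) N)"
        using X_lim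
      proof eventually_elim
        fix \<omega> assume "(\<lambda>n. X n \<omega>) \<longlonglongrightarrow> Z \<omega>"
        then have "(\<lambda>n. \<phi> (X n \<omega>)) \<longlonglongrightarrow> \<phi> (Z \<omega>)"
          by (rule continuous_on_tendsto_compose[OF \<phi>(2)]) auto
        then show "(\<lambda>n. ennreal (min (\<phi> (X n \<omega>)) N)) \<longlonglongrightarrow> ennreal (min (\<phi> (Z \<omega>)) N)"
          by (intro tendsto_ennrealI tendsto_min tendsto_const)
      qed
    qed (auto simp: emeasure_space_1 intro!: ennreal_leI)
    from tendsto_add[OF this tendsto_const]
    have "?m \<le> (\<integral>\<^sup>+\<omega>. ennreal (min (\<phi> (Z \<omega>)) N) \<partial>M) + ennreal (1 / N) * V"
      by (rule LIMSEQ_le_const) (use le in auto)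
    also have "\<dots> \<le> (\<integral>\<^sup>+\<omega>. ennreal (\<phi> (Z \<omega>)) \<partial>M) + ennreal (1 / N) * V"
      by (intro add_right_mono nn_integral_mono ennreal_leI) simp
    finally show ?thesis .
  qed
  obtain v where v: "0 \<le> v" "V = ennreal v"
    using V by (cases V) auto
  show "?m \<le> (\<integral>\<^sup>+\<omega>. ennreal (\<phi> (Z \<omega>)) \<partial>M)"
  proof (rule ennreal_le_epsilon)
    fix e :: real assume e: "0 < e"
    \<comment> \<open>The truncation level \<open>N = (v + 1) / e\<close> makes the error \<open>v / N\<close> smaller than \<open>e\<close>.\<close>
    have "?m \<le> (\<integral>\<^sup>+\<omega>. ennreal (\<phi> (Z \<omega>)) \<partial>M) + ennreal (1 / ((v + 1) / e)) * V"
      by (rule trunc) (use v e in auto)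
    also have "ennreal (1 / ((v + 1) / e)) * V \<le> ennreal e"
      unfolding v(2) using v(1) e
      by (subst ennreal_mult[symmetric]) (auto intro!: ennreal_leI simp: field_simps)
    finally show "?m \<le> (\<integral>\<^sup>+\<omega>. ennreal (\<phi> (Z \<omega>)) \<partial>M) + ennreal e"
      by (simp add: add_left_mono)
  qed
qed

end

section \<open>The augmented filtration\<close>

text \<open>
  Adding null sets to a \<open>\<sigma>\<close>-algebra only changes its members on null sets, so independence
  statements survive the augmentation.
\<close>

lemma sigma_null_sets_AE_eq:
  assumes sub: "sets G \<subseteq> sets M" "space G = space M"
    and A: "A \<in> sigma_sets (space M) (sets G \<union> null_sets M)"
  shows "A \<in> sets M \<and> (\<exists>A'\<in>sets G. AE \<omega> in M. \<omega> \<in> A \<longleftrightarrow> \<omega> \<in> A')"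
  using A
proof induction
  case (Basic A)
  then show ?case
  proof
    assume "A \<in> null_sets M"
    then have "AE \<omega> in M. \<omega> \<in> A \<longleftrightarrow> \<omega> \<in> {}" using AE_not_in by fastforce
    with \<open>A \<in> null_sets M\<close> show ?thesis by blast
  qed (use sub in auto)
next
  case Empty
  show ?case by auto
next
  case (Compl A)
  then obtain A' where A': "A' \<in> sets G" "AE \<omega> in M. \<omega> \<in> A \<longleftrightarrow> \<omega> \<in> A'" by blast
  have "AE \<omega> in M. \<omega> \<in> space M - A \<longleftrightarrow> \<omega> \<in> space G - A'"
    using A'(2) by eventually_elim (use sub in auto)
  with A' Compl show ?case by blast
next
  case (Union A)
  then obtain A' where A': "\<And>i. A' i \<in> sets G" "\<And>i. AE \<omega> in M. \<omega> \<in> A i \<longleftrightarrow> \<omega> \<in> A' i" by metis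
  have "AE \<omega> in M. \<forall>i::nat. \<omega> \<in> A i \<longleftrightarrow> \<omega> \<in> A' i"
    using A'(2) by (simp add: AE_all_countable)
  then have "AE \<omega> in M. \<omega> \<in> (\<Union>i. A i) \<longleftrightarrow> \<omega> \<in> (\<Union>i. A' i)"
    by eventually_elim auto
  moreover have "(\<Union>i. A' i) \<in> sets G" using A'(1) by auto
  ultimately show ?case using Union by blast
qed

lemma
  shows space_augmented_filtration: "space (augmented_filtration M B t) = space M"
    and sets_augmented_filtration: "sets (augmented_filtration M B t)
      = sigma_sets (space M) (sets (natural_filtration M B t) \<union> null_sets M)"
proof -
  have "space (natural_filtration M B t) = space M"
    unfolding natural_filtration_def by (rule space_measure_of) auto
  then have "sets (natural_filtration M B t) \<union> null_sets M \<subseteq> Pow (space M)"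
    using sets.space_closed[of "natural_filtration M B t"] sets.space_closed[of M] by auto
  then show "space (augmented_filtration M B t) = space M"
    "sets (augmented_filtration M B t) = sigma_sets (space M) (sets (natural_filtration M B t) \<union> null_sets M)"
    unfolding augmented_filtration_def by (auto simp: space_measure_of sets_measure_of)
qed

lemma brownian_motion_augmented:
  assumes "brownian_motion M B"
  shows "brownian_motion_wrt M (augmented_filtration M B) B"
proof -
  interpret N: brownian_motion_wrt M "natural_filtration M B" B
    using assms by (simp add: brownian_motion_def)
  note [simp] = space_augmented_filtration sets_augmented_filtration
  show ?thesis
  proof
    show "space (augmented_filtration M B i) = space M" for i by simp
    show "sets (augmented_filtration M B i) \<subseteq> sets (augmented_filtration M B j)" if "i \<le> j" for i j
      using N.sets_F_mono[OF that] by (auto intro!: sigma_sets_mono')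
    show "sets (augmented_filtration M B t) \<subseteq> sets M" if "0 \<le> t" for t
      using sigma_null_sets_AE_eq[OF N.sets_F_subset[OF that] N.space_F] by auto
    show "B t \<in> borel_measurable (augmented_filtration M B t)" if "0 \<le> t" for t
      by (rule measurable_mono[THEN subsetD, OF _ _ _ _ N.adapted[OF that]])
        (auto simp: N.space_F)
    show "AE \<omega> in M. B 0 \<omega> = 0" by (rule N.start)
    show "distributed M lborel (\<lambda>\<omega>. B t \<omega> - B s \<omega>) (normal_density 0 (sqrt (t - s)))"
      if "0 \<le> s" "s < t" for s t
      by (rule N.normal_increments[OF that])
    show "AE \<omega> in M. continuous_on {0..} (\<lambda>t. B t \<omega>)" by (rule N.continuous_paths)
    fix s t :: real
    assume st: "0 \<le> s" "s < t"
    let ?E = "{(\<lambda>\<omega>. B t \<omega> - B s \<omega>) -` A \<inter> space M | A. A \<in> sets borel}"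
    note indep = N.indep_increments[OF st]
    show "N.indep_set (sets (augmented_filtration M B s)) ?E"
    proof (rule N.indep_setI)
      note AE_eq = sigma_null_sets_AE_eq[OF N.sets_F_subset[OF st(1)] N.space_F]
      show "sets (augmented_filtration M B s) \<subseteq> sets M" using AE_eq by auto
      show E: "?E \<subseteq> sets M" by (rule N.indep_setD_ev2[OF indep])
      fix A D assume A: "A \<in> sets (augmented_filtration M B s)" and D: "D \<in> ?E"
      obtain A' where A': "A' \<in> sets (natural_filtration M B s)" "AE \<omega> in M. \<omega> \<in> A \<longleftrightarrow> \<omega> \<in> A'"
        using AE_eq A by auto
      have [measurable]: "A \<in> sets M" "A' \<in> sets M" "D \<in> sets M"
        using AE_eq A A'(1) N.sets_F_subset[OF st(1)] E D by auto
      have "N.prob (A \<inter> D) = N.prob (A' \<inter> D)" "N.prob A = N.prob A'"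
        using A'(2) by (auto intro!: N.finite_measure_eq_AE)
      then show "N.prob (A \<inter> D) = N.prob A * N.prob D"
        using N.indep_setD[OF indep A'(1) D] by simp
    qed
  qed
qed

section \<open>The stochastic differential equation\<close>

lemma AE_outside_null_set:
  assumes "AE \<omega> in M. P \<omega>"
  shows "\<exists>N\<in>null_sets M. \<forall>\<omega>\<in>space M - N. P \<omega>"
  using AE_E3[OF assms] by metis

locale restoring_sde = brownian_motion_wrt M F B + restoring_drift g q
  for M :: "'a measure" and F :: "real \<Rightarrow> 'a measure" and B :: "real \<Rightarrow> 'a \<Rightarrow> real"
    and g :: "real \<Rightarrow> real \<Rightarrow> real" and q :: real +
  fixes \<sigma> :: real
  assumes \<sigma>_pos: "0 < \<sigma>"
begin

lemma sde_solution_pathwise: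
  assumes Y: "sde_solution M F B \<sigma> (\<lambda>s y. - (y * g s y)) Y"
  shows "AE \<omega> in M. continuous_on {0..1} (\<lambda>t. Y t \<omega>) \<and> Y 0 \<omega> = 0 \<and>
    (\<forall>t\<in>{0..1}. Y t \<omega> = \<sigma> * (B t \<omega> - B 0 \<omega>) - (LINT s:{0..<t}|lborel. Y s \<omega> * g s (Y s \<omega>)))"
proof -
  have "(LINT s:A|lborel. - f s) = - (LINT s:A|lborel. f s)" for A and f :: "real \<Rightarrow> real"
    by (simp add: set_lebesgue_integral_def)
  note neg = this
  from Y have "AE \<omega> in M. continuous_on {0..1} (\<lambda>t. Y t \<omega>)" "AE \<omega> in M. Y 0 \<omega> = 0"
    "AE \<omega> in M. \<forall>t\<in>{0..1}. set_integrable lborel {0..<t} (\<lambda>s. - (Y s \<omega> * g s (Y s \<omega>))) \<and>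
      Y t \<omega> = \<sigma> * (B t \<omega> - B 0 \<omega>) + (LINT s:{0..<t}|lborel. - (Y s \<omega> * g s (Y s \<omega>)))"
    unfolding sde_solution_def by blast+
  then show ?thesis by eventually_elim (simp add: neg)
qed

text \<open>
  Almost every path of a solution solves the pathwise equation, which determines it.
\<close>

lemma sde_solution_unique:
  assumes "sde_solution M F B \<sigma> (\<lambda>s y. - (y * g s y)) Y"
    and "sde_solution M F B \<sigma> (\<lambda>s y. - (y * g s y)) Y'"
  shows "AE \<omega> in M. \<forall>t\<in>{0..1}. Y t \<omega> = Y' t \<omega>"
  using sde_solution_pathwise[OF assms(1)] sde_solution_pathwise[OF assms(2)]
proof eventually_elim
  case (elim \<omega>)
  then show ?case
    using solution_unique[of "\<lambda>t. Y t \<omega>" "\<lambda>t. \<sigma> * (B t \<omega> - B 0 \<omega>)" "\<lambda>t. Y' t \<omega>"] by blast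
qed

text \<open>
  The pathwise solution operator is applied to every path of \<open>\<sigma> (B - B\<^sub>0)\<close>; the null set of discontinuous
  paths is first replaced by the zero path. The assumption on null sets keeps this replacement adapted.
\<close>

lemma sde_solution_exists:
  assumes null: "\<And>t. null_sets M \<subseteq> sets (F t)"
  shows "\<exists>Y. sde_solution M F B \<sigma> (\<lambda>s y. - (y * g s y)) Y"
proof -
  from AE_outside_null_set[OF continuous_paths] obtain N
    where N: "N \<in> null_sets M" and paths: "\<forall>\<omega>\<in>space M - N. continuous_on {0..} (\<lambda>t. B t \<omega>)"
    by (rule bexE)
  define w where "w \<omega> t = (if \<omega> \<in> N then 0 else \<sigma> * (B t \<omega> - B 0 \<omega>))" for \<omega> t
  have w_cont: "continuous_on {0..1} (w \<omega>)" if "\<omega> \<in> space M" for \<omega>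
  proof (cases "\<omega> \<in> N")
    case False
    then have "continuous_on {0..} (\<lambda>t. B t \<omega>)" using paths that by blast
    then have "continuous_on {0..1} (\<lambda>t. B t \<omega>)" by (rule continuous_on_subset) auto
    with False show ?thesis unfolding w_def[abs_def] by (auto intro!: continuous_intros)
  qed (simp add: w_def[abs_def])
  have w_meas: "(\<lambda>\<omega>. w \<omega> s) \<in> borel_measurable (F t)" if "0 \<le> s" "s \<le> t" for s t
  proof -
    have [measurable]: "B s \<in> borel_measurable (F t)" "B 0 \<in> borel_measurable (F t)"
      using that by (auto intro: measurable_F_mono[OF adapted])
    have [measurable]: "N \<in> sets (F t)" using N null by blast
    show ?thesis unfolding w_def[abs_def] by measurable
  qed
  define Y where "Y t \<omega> = solution (w \<omega>) t" for t \<omega>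
  have "sde_solution M F B \<sigma> (\<lambda>s y. - (y * g s y)) Y"
    unfolding sde_solution_def
  proof (intro conjI ballI)
    show "Y t \<in> borel_measurable (F t)" if "t \<in> {0..1}" for t
      unfolding Y_def[abs_def]
      by (rule measurable_solution[OF w_meas w_cont that]) (auto simp: space_F)
    have cont: "continuous_on {0..1} (\<lambda>t. Y t \<omega>)" if "\<omega> \<in> space M" for \<omega>
      unfolding Y_def using continuous_on_solution[OF w_cont[OF that]] .
    then show "AE \<omega> in M. continuous_on {0..1} (\<lambda>t. Y t \<omega>)" by (intro AE_I2)
    have eq: "Y t \<omega> = w \<omega> t - (LINT s:{0..<t}|lborel. Y s \<omega> * g s (Y s \<omega>))"
      if "\<omega> \<in> space M" "t \<in> {0..1}" for \<omega> t
      unfolding Y_def by (rule solution_eq[OF w_cont[OF that(1)] that(2)])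
    have Y0: "Y 0 \<omega> = 0" if "\<omega> \<in> space M" for \<omega>
      using eq[OF that, of 0] by (simp add: w_def set_lebesgue_integral_def)
    then show "AE \<omega> in M. Y 0 \<omega> = 0" by (intro AE_I2)
    show "AE \<omega> in M. \<forall>t\<in>{0..1}. set_integrable lborel {0..<t} (\<lambda>s. - (Y s \<omega> * g s (Y s \<omega>))) \<and>
        Y t \<omega> = \<sigma> * (B t \<omega> - B 0 \<omega>) + (LINT s:{0..<t}|lborel. - (Y s \<omega> * g s (Y s \<omega>)))"
      using AE_not_in[OF N] AE_space
    proof (eventually_elim, intro ballI conjI)
      fix \<omega> t assume \<omega>: "\<omega> \<notin> N" "\<omega> \<in> space M" and t: "t \<in> {0..1::real}"
      have "set_integrable lborel {0..<t} (\<lambda>s. Y s \<omega> * g s (Y s \<omega>))"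
        by (rule drift_path_integrable_upto[OF cont[OF \<omega>(2)]]) (use t in auto)
      then show "set_integrable lborel {0..<t} (\<lambda>s. - (Y s \<omega> * g s (Y s \<omega>)))"
        by (simp add: set_integrable_def)
      show "Y t \<omega> = \<sigma> * (B t \<omega> - B 0 \<omega>) + (LINT s:{0..<t}|lborel. - (Y s \<omega> * g s (Y s \<omega>)))"
        using eq[OF \<omega>(2) t] \<omega>(1) by (simp add: w_def set_lebesgue_integral_def)
    qed
  qed
  then show ?thesis by blast
qed

text \<open>
  Here \<open>Z = exp G Y\<^sub>1\<close> is the driftless part. It dominates \<open>\<sigma> (B\<^sub>1 - B\<^sub>0)\<close> in the
  convex order, because the integrating factor, and with it the volatility of \<open>Z\<close>, only grows from its initial
  value.
\<close>

lemma sde_solution_decomposition: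
  assumes null: "\<And>t. null_sets M \<subseteq> sets (F t)"
    and Y: "sde_solution M F B \<sigma> (\<lambda>s y. - (y * g s y)) Y"
  shows "\<exists>G Z. (AE \<omega> in M. Y 1 \<omega> = exp (- G \<omega>) * Z \<omega>) \<and> (\<forall>\<omega>. 0 \<le> G \<omega> \<and> G \<omega> \<le> 2 * q) \<and>
    Z \<in> borel_measurable M \<and> integrable M (\<lambda>\<omega>. (Z \<omega>)\<^sup>2) \<and>
    (\<forall>\<phi>. spread_monotone (\<lambda>x. ennreal (\<phi> x)) \<longrightarrow> continuous_on UNIV \<phi> \<longrightarrow>
      (\<forall>x. 0 \<le> \<phi> x \<and> \<phi> x \<le> \<bar>x\<bar>) \<longrightarrow>
      (\<integral>\<^sup>+\<omega>. ennreal (\<phi> (\<sigma> * (B 1 \<omega> - B 0 \<omega>))) \<partial>M) \<le> (\<integral>\<^sup>+\<omega>. ennreal (\<phi> (Z \<omega>)) \<partial>M))"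
proof -
  have Y_meas: "Y t \<in> borel_measurable (F t)" if "t \<in> {0..1}" for t
    using Y that by (auto simp: sde_solution_def)
  from AE_outside_null_set[OF sde_solution_pathwise[OF Y]] obtain N
    where N: "N \<in> null_sets M" and good0: "\<forall>\<omega>\<in>space M - N. continuous_on {0..1} (\<lambda>t. Y t \<omega>) \<and> Y 0 \<omega> = 0 \<and>
      (\<forall>t\<in>{0..1}. Y t \<omega> = \<sigma> * (B t \<omega> - B 0 \<omega>) - (LINT s:{0..<t}|lborel. Y s \<omega> * g s (Y s \<omega>)))"
    by (rule bexE)
  have good: "continuous_on {0..1} (\<lambda>t. Y t \<omega>)" "Y 0 \<omega> = 0"
    "\<And>t. t \<in> {0..1} \<Longrightarrow> Y t \<omega> = \<sigma> * (B t \<omega> - B 0 \<omega>) - (LINT s:{0..<t}|lborel. Y s \<omega> * g s (Y s \<omega>))"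
    if "\<omega> \<in> space M" "\<omega> \<notin> N" for \<omega>
    using bspec[OF good0, of \<omega>] that by blast+
  \<comment> \<open>The exceptional paths are replaced by \<open>0\<close>, so that every path is continuous and the time integral below is adapted.\<close>
  define y where "y \<omega> t = (if \<omega> \<in> N \<union> - space M then 0 else Y t \<omega>)" for \<omega> t
  have y_cont: "continuous_on {0..1} (y \<omega>)" for \<omega>
    using good(1)[of \<omega>] unfolding y_def[abs_def] by (cases "\<omega> \<in> N \<union> - space M") auto
  define \<alpha> where "\<alpha> t \<omega> = \<sigma> * exp (total_rate (y \<omega>) t)" for t \<omega>
  have \<alpha>_meas: "\<alpha> t \<in> borel_measurable (F t)" if t: "t \<in> {0..1}" for t
  proof -
    have "(\<lambda>\<omega>. y \<omega> s) \<in> borel_measurable (F t)" if "s \<in> {0..t}" for s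
    proof -
      have [measurable]: "Y s \<in> borel_measurable (F t)"
        using that t by (intro measurable_F_mono[OF Y_meas]) auto
      have [measurable]: "N \<in> sets (F t)" using N null by blast
      have "(\<lambda>\<omega>. if \<omega> \<in> N then 0 else Y s \<omega>) \<in> borel_measurable (F t)" by measurable
      then show ?thesis
        by (rule measurable_cong[THEN iffD1, rotated]) (auto simp: y_def space_F)
    qed
    then have "(\<lambda>\<omega>. total_rate (y \<omega>) t) \<in> borel_measurable (F t)"
      unfolding total_rate_def using t
      by (intro measurable_path_integral[OF g_cont]) (auto intro: continuous_on_subset[OF y_cont])
    then show ?thesis unfolding \<alpha>_def[abs_def] by measurable
  qed
  have \<alpha>_bounds: "\<sigma> \<le> \<alpha> t \<omega> \<and> \<alpha> t \<omega> \<le> \<sigma> * exp (2 * q)" if "t \<in> {0..1}" for t \<omega>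
    using total_rate_bounds[OF y_cont that, of \<omega>] \<sigma>_pos by (auto simp: \<alpha>_def)
  define Z where "Z \<omega> = exp (total_rate (y \<omega>) 1) * y \<omega> 1" for \<omega>
  have Z_meas: "Z \<in> borel_measurable M"
  proof -
    have [measurable]: "\<alpha> 1 \<in> borel_measurable M" "Y 1 \<in> borel_measurable M" "N \<in> sets M"
      using measurable_F_imp_M[OF \<alpha>_meas] measurable_F_imp_M[OF Y_meas] N by auto
    have "(\<lambda>\<omega>. \<alpha> 1 \<omega> / \<sigma> * (if \<omega> \<in> N then 0 else Y 1 \<omega>)) \<in> borel_measurable M" by measurable
    then show ?thesis
      by (rule measurable_cong[THEN iffD1, rotated]) (use \<sigma>_pos in \<open>auto simp: Z_def \<alpha>_def y_def\<close>)
  qed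
  have Z_lim: "AE \<omega> in M. (\<lambda>n. \<Sum>i<Suc n. \<alpha> (i / Suc n) \<omega> * (B (Suc i / Suc n) \<omega> - B (i / Suc n) \<omega>))
      \<longlonglongrightarrow> Z \<omega>"
    using AE_not_in[OF N] AE_space
  proof eventually_elim
    fix \<omega> assume \<omega>: "\<omega> \<notin> N" "\<omega> \<in> space M"
    have y: "y \<omega> = (\<lambda>t. Y t \<omega>)" using \<omega> by (simp add: y_def[abs_def])
    let ?w = "\<lambda>t. \<sigma> * (B t \<omega> - B 0 \<omega>)"
    have "(\<lambda>n. \<Sum>i<Suc n. exp (total_rate (y \<omega>) (i / Suc n)) * (?w (Suc i / Suc n) - ?w (i / Suc n)))
        \<longlonglongrightarrow> exp (total_rate (y \<omega>) 1) * y \<omega> 1"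
      unfolding y by (intro integrating_factor_limit good \<omega>)
    also have "(\<lambda>n. \<Sum>i<Suc n. exp (total_rate (y \<omega>) (i / Suc n)) * (?w (Suc i / Suc n) - ?w (i / Suc n)))
        = (\<lambda>n. \<Sum>i<Suc n. \<alpha> (i / Suc n) \<omega> * (B (Suc i / Suc n) \<omega> - B (i / Suc n) \<omega>))"
      by (intro ext sum.cong refl) (simp add: \<alpha>_def algebra_simps)
    finally show "(\<lambda>n. \<Sum>i<Suc n. \<alpha> (i / Suc n) \<omega> * (B (Suc i / Suc n) \<omega> - B (i / Suc n) \<omega>)) \<longlonglongrightarrow> Z \<omega>"
      unfolding Z_def .
  qed
  show ?thesis
  proof (rule exI[of _ "\<lambda>\<omega>. total_rate (y \<omega>) 1"], rule exI[of _ Z], intro conjI allI impI)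
    show "AE \<omega> in M. Y 1 \<omega> = exp (- total_rate (y \<omega>) 1) * Z \<omega>"
      using AE_not_in[OF N] AE_space
      by eventually_elim (simp add: Z_def y_def mult.assoc[symmetric] exp_add[symmetric])
    show "0 \<le> total_rate (y \<omega>) 1" "total_rate (y \<omega>) 1 \<le> 2 * q" for \<omega>
      using total_rate_bounds[OF y_cont, of 1] by simp_all
    show "Z \<in> borel_measurable M" by fact
    show "integrable M (\<lambda>\<omega>. (Z \<omega>)\<^sup>2)"
      by (rule integrable_square_limit[OF \<alpha>_meas \<alpha>_bounds _ Z_meas Z_lim]) (use \<sigma>_pos in auto)
    fix \<phi> :: "real \<Rightarrow> real"
    assume "spread_monotone (\<lambda>x. ennreal (\<phi> x))" "continuous_on UNIV \<phi>" "\<forall>x. 0 \<le> \<phi> x \<and> \<phi> x \<le> \<bar>x\<bar>"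
    then show "(\<integral>\<^sup>+\<omega>. ennreal (\<phi> (\<sigma> * (B 1 \<omega> - B 0 \<omega>))) \<partial>M) \<le> (\<integral>\<^sup>+\<omega>. ennreal (\<phi> (Z \<omega>)) \<partial>M)"
      by (intro nn_integral_limit_ge[OF \<alpha>_meas \<alpha>_bounds _ Z_meas Z_lim]) (use \<sigma>_pos in auto)
  qed
qed

end

section \<open>Gaussian expectations and the comparison at time 1\<close>

context brownian_motion_wrt
begin

lemma integrable_increment:
  assumes "0 \<le> s" "s < t"
  shows "integrable M (\<lambda>\<omega>. B t \<omega> - B s \<omega>)"
proof (rule square_integrable_imp_integrable)
  have [measurable]: "B t \<in> borel_measurable M" "B s \<in> borel_measurable M"
    using assms by (auto intro: measurable_B)
  show "(\<lambda>\<omega>. B t \<omega> - B s \<omega>) \<in> borel_measurable M" by measurable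
  show "integrable M (\<lambda>\<omega>. (B t \<omega> - B s \<omega>)\<^sup>2)"
    using nn_integral_square_increment_finite[OF assms, of 1] by (intro integrableI_bounded) simp_all
qed

text \<open>
  Brownian scaling at a single time: both sides integrate \<open>\<phi>\<close> against the normal law of variance \<open>\<sigma>\<^sup>2\<close>.
\<close>

lemma nn_integral_scaled_increment:
  assumes "0 < \<sigma>" and [measurable]: "\<phi> \<in> borel_measurable borel"
  shows "(\<integral>\<^sup>+\<omega>. \<phi> (\<sigma> * (B 1 \<omega> - B 0 \<omega>)) \<partial>M) = (\<integral>\<^sup>+\<omega>. \<phi> (B (\<sigma>\<^sup>2) \<omega>) \<partial>M)"
proof -
  have "distributed M lborel (\<lambda>\<omega>. B 1 \<omega> - B 0 \<omega>) (normal_density 0 1)"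
    using normal_increments[of 0 1] by simp
  then have "distributed M lborel (\<lambda>\<omega>. 0 + \<sigma> * (B 1 \<omega> - B 0 \<omega>)) (normal_density (0 + \<sigma> * 0) (\<bar>\<sigma>\<bar> * 1))"
    by (rule normal_density_affine) (use \<open>0 < \<sigma>\<close> in auto)
  then have scaled: "distributed M lborel (\<lambda>\<omega>. \<sigma> * (B 1 \<omega> - B 0 \<omega>)) (normal_density 0 \<sigma>)"
    using \<open>0 < \<sigma>\<close> by simp
  have direct: "distributed M lborel (\<lambda>\<omega>. B (\<sigma>\<^sup>2) \<omega> - B 0 \<omega>) (normal_density 0 \<sigma>)"
    using normal_increments[of 0 "\<sigma>\<^sup>2"] \<open>0 < \<sigma>\<close> by simp
  have "(\<integral>\<^sup>+\<omega>. \<phi> (\<sigma> * (B 1 \<omega> - B 0 \<omega>)) \<partial>M) = (\<integral>\<^sup>+\<omega>. \<phi> (B (\<sigma>\<^sup>2) \<omega> - B 0 \<omega>) \<partial>M)"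
    using distributed_nn_integral[OF scaled, of \<phi>] distributed_nn_integral[OF direct, of \<phi>] by simp
  also have "\<dots> = (\<integral>\<^sup>+\<omega>. \<phi> (B (\<sigma>\<^sup>2) \<omega>) \<partial>M)"
    using start by (intro nn_integral_cong_AE) (auto elim: eventually_mono)
  finally show ?thesis .
qed

lemma integrable_B:
  assumes "0 < t"
  shows "integrable M (B t)"
proof (rule integrable_cong_AE_imp[OF integrable_increment[of 0 t]])
  show "B t \<in> borel_measurable M" using assms by (intro measurable_B) simp
  show "AE \<omega> in M. B t \<omega> - B 0 \<omega> = B t \<omega>" using start by (auto elim: eventually_mono)
qed (use assms in auto)

text \<open>
  The normal density is positive everywhere, so an almost sure bound on \<open>a B\<^sub>t\<close> would hold at Lebesgue-almost every
  point; it fails on an interval of length \<open>1\<close>.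
\<close>

lemma AE_affine_B_le_imp_False:
  assumes t: "0 < t" and "a \<noteq> 0" and AE: "AE \<omega> in M. a * B t \<omega> \<le> x"
  shows False
proof -
  have "AE \<omega> in M. a * (B t \<omega> - B 0 \<omega>) \<le> x"
    using AE start by eventually_elim simp
  moreover have "distributed M lborel (\<lambda>\<omega>. B t \<omega> - B 0 \<omega>) (normal_density 0 (sqrt t))"
    using normal_increments[of 0 t] t by simp
  ultimately have "AE z in lborel. 0 < ennreal (normal_density 0 (sqrt t) z) \<longrightarrow> a * z \<le> x"
    by (subst distributed_AE2[symmetric]) auto
  then have AE_z: "AE z in lborel. a * z \<le> x"
    using t by (simp add: normal_density_pos)
  obtain l where l: "\<And>z. z \<in> {l<..<l+1} \<Longrightarrow> \<not> a * z \<le> x"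
  proof (cases "0 < a")
    case True
    then show ?thesis by (intro that[of "x / a"]) (auto simp: field_simps)
  next
    case False
    with \<open>a \<noteq> 0\<close> have "a < 0" by simp
    then show ?thesis by (intro that[of "x / a - 1"]) (auto simp: field_simps)
  qed
  have "AE z in lborel. z \<notin> {l<..<l+1}"
    using AE_z by eventually_elim (use l in blast)
  then have "{l<..<l+1} \<in> null_sets lborel"
    by (subst AE_iff_null_sets) auto
  then show False by (simp add: null_sets_def)
qed

lemma expectation_positive_part_pos:
  assumes t: "0 < t" and "a \<noteq> 0"
  shows "0 < (\<integral>\<omega>. max (a * B t \<omega> - x) 0 \<partial>M)"
proof -
  have int: "integrable M (\<lambda>\<omega>. max (a * B t \<omega> - x) 0)"
    using integrable_B[OF t] by auto
  have "(\<integral>\<omega>. max (a * B t \<omega> - x) 0 \<partial>M) \<noteq> 0"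
  proof
    assume "(\<integral>\<omega>. max (a * B t \<omega> - x) 0 \<partial>M) = 0"
    then have "AE \<omega> in M. max (a * B t \<omega> - x) 0 = 0"
      using integral_nonneg_eq_0_iff_AE[OF int] by simp
    then have "AE \<omega> in M. a * B t \<omega> \<le> x" by eventually_elim simp
    then show False by (rule AE_affine_B_le_imp_False[OF assms])
  qed
  moreover have "0 \<le> (\<integral>\<omega>. max (a * B t \<omega> - x) 0 \<partial>M)" by simp
  ultimately show ?thesis by linarith
qed

end

context restoring_sde
begin

text \<open>
  The sign \<open>s\<close> selects the upper or the lower tail. With \<open>Y\<^sub>1 = exp (- G) Z\<close>, the factor
  \<open>exp (- G)\<close> may be replaced by its lower bound \<open>exp (- 2 q)\<close> where \<open>s Z \<ge> 0\<close>; where \<open>s Z < 0\<close>, the positivity of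
  \<open>x\<close> makes \<open>(s exp (- 2 q) Z - x)\<^sup>+\<close> vanish.
\<close>

lemma positive_part_comparison:
  assumes null: "\<And>t. null_sets M \<subseteq> sets (F t)"
    and Y: "sde_solution M F B \<sigma> (\<lambda>s y. - (y * g s y)) Y"
    and s: "\<bar>s\<bar> = 1" and x: "0 < x"
  shows "(\<integral>\<omega>. max (s * exp (- 2 * q) * B (\<sigma>\<^sup>2) \<omega> - x) 0 \<partial>M) \<le> (\<integral>\<omega>. max (s * Y 1 \<omega> - x) 0 \<partial>M)"
proof -
  let ?k = "exp (- 2 * q)"
  let ?\<phi> = "\<lambda>z. max (s * ?k * z - x) 0"
  obtain G Z where Y1: "AE \<omega> in M. Y 1 \<omega> = exp (- G \<omega>) * Z \<omega>"
    and G: "\<forall>\<omega>. 0 \<le> G \<omega> \<and> G \<omega> \<le> 2 * q"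
    and Z: "Z \<in> borel_measurable M" "integrable M (\<lambda>\<omega>. (Z \<omega>)\<^sup>2)"
    and cmp: "\<forall>\<phi>. spread_monotone (\<lambda>x. ennreal (\<phi> x)) \<longrightarrow> continuous_on UNIV \<phi> \<longrightarrow>
      (\<forall>x. 0 \<le> \<phi> x \<and> \<phi> x \<le> \<bar>x\<bar>) \<longrightarrow>
      (\<integral>\<^sup>+\<omega>. ennreal (\<phi> (\<sigma> * (B 1 \<omega> - B 0 \<omega>))) \<partial>M) \<le> (\<integral>\<^sup>+\<omega>. ennreal (\<phi> (Z \<omega>)) \<partial>M)"
    using sde_solution_decomposition[OF null Y] by (elim exE conjE)
  have k: "0 < ?k" "?k \<le> 1" using q_nonneg by auto
  have Zint: "integrable M Z" by (rule square_integrable_imp_integrable[OF Z])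
  have Y1_meas: "Y 1 \<in> borel_measurable M"
    using Y by (auto simp: sde_solution_def intro: measurable_F_imp_M[of _ 1])
  have Yint: "integrable M (Y 1)"
  proof (rule Bochner_Integration.integrable_bound[OF Zint Y1_meas])
    show "AE \<omega> in M. norm (Y 1 \<omega>) \<le> norm (Z \<omega>)"
      using Y1
    proof eventually_elim
      case (elim \<omega>)
      have "exp (- G \<omega>) * \<bar>Z \<omega>\<bar> \<le> 1 * \<bar>Z \<omega>\<bar>" using G by (intro mult_right_mono) auto
      with elim show ?case by (simp add: abs_mult)
    qed
  qed
  have dominated: "AE \<omega> in M. ?\<phi> (Z \<omega>) \<le> max (s * Y 1 \<omega> - x) 0"
    using Y1
  proof eventually_elim
    case (elim \<omega>)
    show ?case
    proof (cases "0 \<le> s * Z \<omega>")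
      case True
      then have "?k * (s * Z \<omega>) \<le> exp (- G \<omega>) * (s * Z \<omega>)"
        using G by (intro mult_right_mono) auto
      then show ?thesis using elim by (simp add: mult_ac)
    next
      case False
      then have "?k * (s * Z \<omega>) \<le> 0" using mult_nonneg_nonpos[of ?k "s * Z \<omega>"] k by linarith
      then show ?thesis using x by (simp add: mult_ac)
    qed
  qed
  have Bint: "integrable M (\<lambda>\<omega>. ?\<phi> (B (\<sigma>\<^sup>2) \<omega>))"
    using integrable_B[of "\<sigma>\<^sup>2"] \<sigma>_pos by auto
  have "ennreal (\<integral>\<omega>. ?\<phi> (B (\<sigma>\<^sup>2) \<omega>) \<partial>M) = (\<integral>\<^sup>+\<omega>. ennreal (?\<phi> (B (\<sigma>\<^sup>2) \<omega>)) \<partial>M)"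
    by (rule nn_integral_eq_integral[symmetric, OF Bint]) simp
  also have "\<dots> = (\<integral>\<^sup>+\<omega>. ennreal (?\<phi> (\<sigma> * (B 1 \<omega> - B 0 \<omega>))) \<partial>M)"
    by (rule nn_integral_scaled_increment[OF \<sigma>_pos, symmetric]) measurable
  also have "\<dots> \<le> (\<integral>\<^sup>+\<omega>. ennreal (?\<phi> (Z \<omega>)) \<partial>M)"
  proof (rule cmp[rule_format])
    show "spread_monotone (\<lambda>z. ennreal (?\<phi> z))" by (rule spread_monotone_positive_part)
    show "continuous_on UNIV ?\<phi>" by (intro continuous_intros)
    show "0 \<le> ?\<phi> z \<and> ?\<phi> z \<le> \<bar>z\<bar>" for z
    proof -
      have "s * ?k * z \<le> \<bar>s * ?k * z\<bar>" by simp
      also have "\<dots> = ?k * \<bar>z\<bar>" using s by (simp add: abs_mult)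
      also have "\<dots> \<le> \<bar>z\<bar>" using k by (simp add: mult_left_le_one_le)
      finally show ?thesis using x by auto
    qed
  qed
  also have "\<dots> \<le> (\<integral>\<^sup>+\<omega>. ennreal (max (s * Y 1 \<omega> - x) 0) \<partial>M)"
    by (intro nn_integral_mono_AE eventually_mono[OF dominated] ennreal_leI)
  also have "\<dots> = ennreal (\<integral>\<omega>. max (s * Y 1 \<omega> - x) 0 \<partial>M)"
    by (rule nn_integral_eq_integral) (use Yint in auto)
  finally show ?thesis by (subst (asm) ennreal_le_iff) auto
qed

end

theorem lemma4p1:
  fixes M :: "'a measure" and B :: "real \<Rightarrow> 'a \<Rightarrow> real"
    and H :: "real \<Rightarrow> real \<Rightarrow> real" and \<sigma> c C :: real
  defines "b \<equiv> \<lambda>t y. - c * y * deriv (H t) y"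
  assumes "\<sigma> > 0"
    and "brownian_motion M B"
    and "C12_on {0..<1} H"
    and "\<And>t y. t \<in> {0..<1} \<Longrightarrow> 0 \<le> deriv (H t) y \<and> deriv (H t) y \<le> C * (1 / sqrt (1 - t))"
    and "c \<ge> 0"
  shows "has_unique_strong_solution M B \<sigma> b \<and>
    (\<forall>Y. strong_solution M B \<sigma> b Y \<longrightarrow>
      (\<forall>x>0.
        (\<integral>\<omega>. max (Y 1 \<omega> - x) 0 \<partial>M) \<ge> (\<integral>\<omega>. max (exp (- 2 * c * C) * B (\<sigma>\<^sup>2) \<omega> - x) 0 \<partial>M) \<and>
        (\<integral>\<omega>. max (exp (- 2 * c * C) * B (\<sigma>\<^sup>2) \<omega> - x) 0 \<partial>M) > 0 \<and>
        (\<integral>\<omega>. max (- x - Y 1 \<omega>) 0 \<partial>M) \<ge> (\<integral>\<omega>. max (- x - exp (- 2 * c * C) * B (\<sigma>\<^sup>2) \<omega>) 0 \<partial>M) \<and>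
        (\<integral>\<omega>. max (- x - exp (- 2 * c * C) * B (\<sigma>\<^sup>2) \<omega>) 0 \<partial>M) > 0) \<and>
      (\<forall>y. measure M {\<omega> \<in> space M. Y 1 \<omega> \<le> y} \<in> {0<..<1}))"
proof -
  let ?g = "\<lambda>t y. c * deriv (H t) y"
  have b: "b = (\<lambda>t y. - (y * ?g t y))"
    by (simp add: b_def fun_eq_iff mult_ac)
  have drift: "restoring_drift ?g (c * C)"
    by (rule restoring_drift_C12) (use assms in auto)
  interpret A: brownian_motion_wrt M "augmented_filtration M B" B
    by (rule brownian_motion_augmented) fact
  interpret S: restoring_sde M "augmented_filtration M B" B ?g "c * C" \<sigma>
    using A.brownian_motion_wrt_axioms drift \<open>\<sigma> > 0\<close>
    by (simp add: restoring_sde_def restoring_sde_axioms_def)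
  have null: "null_sets M \<subseteq> sets (augmented_filtration M B t)" for t
    unfolding sets_augmented_filtration by auto
  have "\<exists>Y. strong_solution M B \<sigma> b Y"
    unfolding strong_solution_def b by (rule S.sde_solution_exists[OF null])
  moreover have "AE \<omega> in M. \<forall>t\<in>{0..1}. Y t \<omega> = Y' t \<omega>"
    if "brownian_motion_wrt M F B" "sde_solution M F B \<sigma> b Y" "sde_solution M F B \<sigma> b Y'" for F Y Y'
  proof -
    interpret F: restoring_sde M F B ?g "c * C" \<sigma>
      using that(1) drift \<open>\<sigma> > 0\<close> by (simp add: restoring_sde_def restoring_sde_axioms_def)
    show ?thesis using that(2,3) unfolding b by (rule F.sde_solution_unique)
  qed
  ultimately have unique: "has_unique_strong_solution M B \<sigma> b"
    unfolding has_unique_strong_solution_def by blast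
  let ?k = "exp (- 2 * c * C)"
  have \<sigma>2: "0 < \<sigma>\<^sup>2" using \<open>\<sigma> > 0\<close> by simp
  have neg: "max (- x - r) 0 = max (- 1 * r - x) 0" for x r :: real by simp
  show ?thesis
  proof (intro conjI allI impI unique)
    fix Y assume Y: "strong_solution M B \<sigma> b Y"
    note cmp = S.positive_part_comparison[OF null Y[unfolded strong_solution_def b]]
    have up: "(\<integral>\<omega>. max (?k * B (\<sigma>\<^sup>2) \<omega> - x) 0 \<partial>M) \<le> (\<integral>\<omega>. max (Y 1 \<omega> - x) 0 \<partial>M)" if "0 < x" for x
      using cmp[of 1 x] that by (simp add: mult.assoc)
    have up_pos: "0 < (\<integral>\<omega>. max (?k * B (\<sigma>\<^sup>2) \<omega> - x) 0 \<partial>M)" for x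
      by (rule A.expectation_positive_part_pos[OF \<sigma>2]) simp
    have down: "(\<integral>\<omega>. max (- x - ?k * B (\<sigma>\<^sup>2) \<omega>) 0 \<partial>M) \<le> (\<integral>\<omega>. max (- x - Y 1 \<omega>) 0 \<partial>M)" if "0 < x" for x
      using cmp[of "-1" x] that unfolding neg by (simp add: mult.assoc)
    have down_pos: "0 < (\<integral>\<omega>. max (- x - ?k * B (\<sigma>\<^sup>2) \<omega>) 0 \<partial>M)" for x
      using A.expectation_positive_part_pos[OF \<sigma>2, of "- ?k" x] unfolding neg by simp
    {
      fix x :: real assume "0 < x"
      then show "(\<integral>\<omega>. max (?k * B (\<sigma>\<^sup>2) \<omega> - x) 0 \<partial>M) \<le> (\<integral>\<omega>. max (Y 1 \<omega> - x) 0 \<partial>M)"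
        "0 < (\<integral>\<omega>. max (?k * B (\<sigma>\<^sup>2) \<omega> - x) 0 \<partial>M)"
        "(\<integral>\<omega>. max (- x - ?k * B (\<sigma>\<^sup>2) \<omega>) 0 \<partial>M) \<le> (\<integral>\<omega>. max (- x - Y 1 \<omega>) 0 \<partial>M)"
        "0 < (\<integral>\<omega>. max (- x - ?k * B (\<sigma>\<^sup>2) \<omega>) 0 \<partial>M)"
        using up[of x] up_pos[of x] down[of x] down_pos[of x] by simp_all
    }
    fix y :: real
    have [measurable]: "Y 1 \<in> borel_measurable M"
      using Y by (auto simp: strong_solution_def sde_solution_def intro: A.measurable_F_imp_M[of _ 1])
    have ge_1: "0 < max 1 r" for r :: real by (simp add: less_max_iff_disj)
    let ?E = "{\<omega> \<in> space M. Y 1 \<omega> \<le> y}"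
    have "measure M ?E \<noteq> 0"
    proof
      assume "measure M ?E = 0"
      then have "AE \<omega> in M. \<not> Y 1 \<omega> \<le> y"
        by (subst (asm) A.prob_Collect_eq_0) auto
      \<comment> \<open>The level \<open>max 1 (- y)\<close> is positive, and \<open>- max 1 (- y) \<le> y < Y\<^sub>1\<close>.\<close>
      then have "AE \<omega> in M. max (- max 1 (- y) - Y 1 \<omega>) 0 = 0"
        by eventually_elim auto
      then have "(\<integral>\<omega>. max (- max 1 (- y) - Y 1 \<omega>) 0 \<partial>M) = 0"
        by (rule integral_eq_zero_AE)
      with down[OF ge_1] down_pos[of "max 1 (- y)"] show False by (metis not_less)
    qed
    moreover have "measure M ?E \<noteq> 1"
    proof
      assume "measure M ?E = 1"
      then have "AE \<omega> in M. Y 1 \<omega> \<le> y"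
        by (subst (asm) A.prob_Collect_eq_1) auto
      then have "AE \<omega> in M. max (Y 1 \<omega> - max 1 y) 0 = 0"
        by eventually_elim auto
      then have "(\<integral>\<omega>. max (Y 1 \<omega> - max 1 y) 0 \<partial>M) = 0"
        by (rule integral_eq_zero_AE)
      with up[OF ge_1] up_pos[of "max 1 y"] show False by (metis not_less)
    qed
    ultimately show "measure M ?E \<in> {0<..<1}"
      using A.prob_le_1[of ?E] measure_nonneg[of M ?E] by (simp add: order_less_le)
  qed
qed

end
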